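(* Let $A\in\mathbb R^{m\times r}$, $B\in\mathbb R^{p\times q}$, $F\in\mathbb R^{m\times q}$, and consider $n$ agents whose communication is described by an undirected graph $\mathcal G$ with node set $\{1,\ldots,n\}$. If $\mathcal G$ is connected, then for each of the eight information structures RCC, RRR, CCR, CRR, RCR, CCC, RRC, CRC, a least squares solution to $AXB=F$ can be obtained by a distributed algorithm with an exponential convergence rate. That is, there is a distributed continuous-time algorithm such that, for any initial condition, the agents' estimates converge exponentially to a least squares solution $X^*\in\mathbb R^{r\times p}$ of $AXB=F$: in structures RCC, CCR, RCR and RRC, the estimate $X_i(t)\in\mathbb R^{r\times p}$ of every agent $i$ converges exponentially to $X^*$; in structures RRR and CRR, the estimate $X_{li}(t)\in\mathbb R^{r\times p_i}$ of agent $i$ converges exponentially to the $i$th column-block of $X^*$; in structures CCC and CRC, the estimate $X_{vi}(t)\in\mathbb R^{r_i\times p}$ of agent $i$ converges exponentially to the $i$th row-block of $X^*$.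
   Context: A least squares solution to $AXB=F$ is a minimizer $X\in\mathbb R^{r\times p}$ of $\|AXB-F\|_{\rm F}^2$ ($\|\cdot\|_{\rm F}$ is the Frobenius norm). The graph $\mathcal G$ has a symmetric adjacency matrix $[a_{i,j}]\in\mathbb R^{n\times n}$ with $a_{i,j}=a_{j,i}>0$ if $\{j,i\}$ is an edge and $a_{i,j}=0$ otherwise; $j$ is a neighbor of $i$ if $\{j,i\}$ is an edge. Information structures. Let $m_i,r_i,p_i,q_i$ ($i=1,\ldots,n$) be positive integers (as needed in the given structure) with $\sum_i m_i=m$, $\sum_i r_i=r$, $\sum_i p_i=p$, $\sum_i q_i=q$. A structure is named by three letters referring in order to $A$, $B$, $F$; the letter R (row) means the matrix is partitioned into $n$ row-blocks and C (column) means it is partitioned into $n$ column-blocks; agent $i$ knows only the $i$th block of each of the three matrices. Row-blocks of $A$ are $A_{vi}\in\mathbb R^{m_i\times r}$, column-blocks of $A$ are $A_{li}\in\mathbb R^{m\times r_i}$; row-blocks of $B$ are $B_{vi}\in\mathbb R^{p_i\times q}$, column-blocks of $B$ are $B_{li}\in\mathbb R^{p\times q_i}$; row-blocks of $F$ are $F_{vi}\in\mathbb R^{m_i\times q}$, column-blocks of $F$ are $F_{li}\in\mathbb R^{m\times q_i}$. For example, in RCC agent $i$ knows $A_{vi},B_{li},F_{li}$; in CRR agent $i$ knows $A_{li},B_{vi},F_{vi}$. Column-blocks of $X$ are $X_{li}\in\mathbb R^{r\times p_i}$, row-blocks of $X$ are $X_{vi}\in\mathbb R^{r_i\times p}$.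 Distributed (continuous-time) algorithm: each agent $i$ holds a finite-dimensional state $s_i(t)$, $t\ge 0$, one of whose components is its estimate ($X_i$, $X_{li}$ or $X_{vi}$), and $\dot s_i(t)$ is given by a rule $g_i$ whose arguments are $s_i(t)$, $\dot s_i(t)$ and the states $s_j(t)$ and derivatives $\dot s_j(t)$ of the neighbors $j$ of $i$ (the resulting overall system being a well-defined autonomous ordinary differential equation $\dot s=\phi(s)$ with Lipschitz $\phi$); the rule $g_i$ may depend only on $i$, $n$, the matrix dimensions and block sizes, the weights $(a_{i,j})_{j}$ and the three data blocks known to agent $i$. A function $z(t)$ converges exponentially to $z^*$ if there are constants $c\ge0$, $\mu>0$ with $\|z(t)-z^*\|\le c\,e^{-\mu t}$ for all $t\ge 0$. The limit $X^*$ may depend on the initial condition. *)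

theory Defs
  imports
    Complex_Main
    "HOL-Library.FuncSet"
    "Jordan_Normal_Form.Matrix"
    "Graph_Theory.Graph_Theory"
begin

section \<open>Least squares solutions\<close>

definition frob_norm :: "real mat \<Rightarrow> real" where
  "frob_norm M = sqrt (\<Sum>k<dim_row M. \<Sum>l<dim_col M. (M $$ (k, l))\<^sup>2)"

definition least_squares_solution :: "real mat \<Rightarrow> real mat \<Rightarrow> real mat \<Rightarrow> real mat \<Rightarrow> bool" where
  "least_squares_solution A B F X \<longleftrightarrow>
     X \<in> carrier_mat (dim_col A) (dim_row B) \<and>
     (\<forall>Y \<in> carrier_mat (dim_col A) (dim_row B).
        (frob_norm (A * X * B - F))\<^sup>2 \<le> (frob_norm (A * Y * B - F))\<^sup>2)"


section \<open>Communication graph\<close>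

text \<open>Agents are numbered from 0 to \<open>n - 1\<close>. As usual in the graph library, an undirected simple
  graph is a symmetric loop-free digraph, the edge between \<open>i\<close> and \<open>j\<close> being the two arcs
  \<open>(i, j)\<close> and \<open>(j, i)\<close>.\<close>

definition connected_graph_on :: "nat \<Rightarrow> nat pair_pre_digraph \<Rightarrow> bool" where
  "connected_graph_on n G \<longleftrightarrow>
     pair_graph G \<and> pverts G = {..<n} \<and> Digraph_Component.connected (with_proj G)"

definition weighted_adjacency :: "nat \<Rightarrow> nat pair_pre_digraph \<Rightarrow> real mat \<Rightarrow> bool" where
  "weighted_adjacency n G W \<longleftrightarrow> W \<in> carrier_mat n n \<and>
     (\<forall>i<n. \<forall>j<n. W $$ (i, j) = W $$ (j, i) \<and>
        (if (i, j) \<in> parcs G then W $$ (i, j) > 0 else W $$ (i, j) = 0))"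


section \<open>Information structures\<close>

datatype letter = R | C

definition block_sizes :: "nat \<Rightarrow> (nat \<Rightarrow> nat) \<Rightarrow> nat \<Rightarrow> bool" where
  "block_sizes n sz N \<longleftrightarrow> (\<forall>i<n. 0 < sz i) \<and> (\<Sum>i<n. sz i) = N"

definition row_block :: "(nat \<Rightarrow> nat) \<Rightarrow> nat \<Rightarrow> real mat \<Rightarrow> real mat" where
  "row_block sz i M = mat (sz i) (dim_col M) (\<lambda>(k, l). M $$ ((\<Sum>j<i. sz j) + k, l))"

definition col_block :: "(nat \<Rightarrow> nat) \<Rightarrow> nat \<Rightarrow> real mat \<Rightarrow> real mat" where
  "col_block sz i M = mat (dim_row M) (sz i) (\<lambda>(k, l). M $$ (k, (\<Sum>j<i. sz j) + l))"

fun block :: "letter \<Rightarrow> (nat \<Rightarrow> nat) \<Rightarrow> (nat \<Rightarrow> nat) \<Rightarrow> nat \<Rightarrow> real mat \<Rightarrow> real mat" where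
  "block R rsz csz i M = row_block rsz i M"
| "block C rsz csz i M = col_block csz i M"

type_synonym data = "real mat \<times> real mat \<times> real mat"

definition known_data ::
  "letter \<Rightarrow> letter \<Rightarrow> letter \<Rightarrow> (nat \<Rightarrow> nat) \<Rightarrow> (nat \<Rightarrow> nat) \<Rightarrow> (nat \<Rightarrow> nat) \<Rightarrow> (nat \<Rightarrow> nat) \<Rightarrow>
   real mat \<Rightarrow> real mat \<Rightarrow> real mat \<Rightarrow> nat \<Rightarrow> data" where
  "known_data lA lB lF ms rs ps qs A B F i =
     (block lA ms rs i A, block lB ps qs i B, block lF ms qs i F)"

text \<open>The part of the solution that each agent estimates: all of \<open>X\<close>, its column-block, or its
  row-block.\<close>

datatype part = Full | Column_Block | Row_Block

fun estimated_part :: "letter \<Rightarrow> letter \<Rightarrow> letter \<Rightarrow> part" where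
  "estimated_part R C C = Full"
| "estimated_part R R R = Column_Block"
| "estimated_part C C R = Full"
| "estimated_part C R R = Column_Block"
| "estimated_part R C R = Full"
| "estimated_part C C C = Row_Block"
| "estimated_part R R C = Full"
| "estimated_part C R C = Row_Block"

fun part_carrier :: "part \<Rightarrow> nat \<Rightarrow> nat \<Rightarrow> (nat \<Rightarrow> nat) \<Rightarrow> (nat \<Rightarrow> nat) \<Rightarrow> nat \<Rightarrow> real mat set" where
  "part_carrier Full r p rs ps i = carrier_mat r p"
| "part_carrier Column_Block r p rs ps i = carrier_mat r (ps i)"
| "part_carrier Row_Block r p rs ps i = carrier_mat (rs i) p"

fun part_of :: "part \<Rightarrow> (nat \<Rightarrow> nat) \<Rightarrow> (nat \<Rightarrow> nat) \<Rightarrow> nat \<Rightarrow> real mat \<Rightarrow> real mat" where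
  "part_of Full rs ps i X = X"
| "part_of Column_Block rs ps i X = col_block ps i X"
| "part_of Row_Block rs ps i X = row_block rs i X"


section \<open>Distributed continuous-time algorithms\<close>

text \<open>The state of an agent is its estimate together with an auxiliary vector that collects all
  its other variables.\<close>

type_synonym state = "real mat \<times> real vec"

text \<open>The arguments of a rule are: the agent \<open>i\<close>, its row of the adjacency matrix, its data blocks,
  its own state, its own derivative, and the states and derivatives of its neighbors
  (\<open>None\<close> for agents that are not neighbors).\<close>

type_synonym algorithm =
  "nat \<Rightarrow> real vec \<Rightarrow> data \<Rightarrow> state \<Rightarrow> state \<Rightarrow> (nat \<Rightarrow> (state \<times> state) option) \<Rightarrow> state"

definition network_states :: "nat \<Rightarrow> (nat \<Rightarrow> real mat set) \<Rightarrow> (nat \<Rightarrow> nat) \<Rightarrow> (nat \<Rightarrow> state) set" where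
  "network_states n est_carrier aux_dim = (\<Pi>\<^sub>E i\<in>{..<n}. est_carrier i \<times> carrier_vec (aux_dim i))"

text \<open>\<open>obeys_rules n G W dat g S D\<close>: in network state \<open>S\<close>, the derivatives \<open>D\<close> satisfy the rules of
  all agents. This is an implicit equation for \<open>D\<close>, since rules may use derivatives.\<close>

definition obeys_rules ::
  "nat \<Rightarrow> nat pair_pre_digraph \<Rightarrow> real mat \<Rightarrow> (nat \<Rightarrow> data) \<Rightarrow> algorithm \<Rightarrow>
   (nat \<Rightarrow> state) \<Rightarrow> (nat \<Rightarrow> state) \<Rightarrow> bool" where
  "obeys_rules n G W dat g S D \<longleftrightarrow>
     (\<forall>i<n. D i = g i (row W i) (dat i) (S i) (D i)
        (\<lambda>j. if (i, j) \<in> parcs G then Some (S j, D j) else None))"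

definition network_dist :: "nat \<Rightarrow> (nat \<Rightarrow> state) \<Rightarrow> (nat \<Rightarrow> state) \<Rightarrow> real" where
  "network_dist n S T =
     sqrt (\<Sum>i<n. (frob_norm (fst (S i) - fst (T i)))\<^sup>2 +
                   (snd (S i) - snd (T i)) \<bullet> (snd (S i) - snd (T i)))"

text \<open>The implicit system \<open>P S D\<close> on the state space \<open>V\<close> is an autonomous ordinary differential
  equation \<open>D = \<phi> S\<close> with Lipschitz right-hand side.\<close>

definition lipschitz_ode ::
  "nat \<Rightarrow> (nat \<Rightarrow> state) set \<Rightarrow> ((nat \<Rightarrow> state) \<Rightarrow> (nat \<Rightarrow> state) \<Rightarrow> bool) \<Rightarrow> bool" where
  "lipschitz_ode n V P \<longleftrightarrow> (\<exists>\<phi> L.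
     (\<forall>S\<in>V. \<phi> S \<in> V) \<and>
     (\<forall>S\<in>V. \<forall>T\<in>V. network_dist n (\<phi> S) (\<phi> T) \<le> L * network_dist n S T) \<and>
     (\<forall>S\<in>V. \<forall>D\<in>V. P S D \<longleftrightarrow> D = \<phi> S))"

text \<open>Entrywise derivative on the time interval \<open>[0, \<infinity>)\<close>, one-sided at \<open>0\<close>.\<close>

definition has_network_derivative ::
  "nat \<Rightarrow> (real \<Rightarrow> nat \<Rightarrow> state) \<Rightarrow> (nat \<Rightarrow> state) \<Rightarrow> real \<Rightarrow> bool" where
  "has_network_derivative n s D t \<longleftrightarrow> (\<forall>i<n.
     (\<forall>k<dim_row (fst (D i)). \<forall>l<dim_col (fst (D i)).
        ((\<lambda>u. fst (s u i) $$ (k, l)) has_real_derivative fst (D i) $$ (k, l)) (at t within {0..})) \<and>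
     (\<forall>k<dim_vec (snd (D i)).
        ((\<lambda>u. snd (s u i) $ k) has_real_derivative snd (D i) $ k) (at t within {0..})))"

definition trajectory ::
  "nat \<Rightarrow> (nat \<Rightarrow> state) set \<Rightarrow> ((nat \<Rightarrow> state) \<Rightarrow> (nat \<Rightarrow> state) \<Rightarrow> bool) \<Rightarrow>
   (nat \<Rightarrow> state) \<Rightarrow> (real \<Rightarrow> nat \<Rightarrow> state) \<Rightarrow> bool" where
  "trajectory n V P S\<^sub>0 s \<longleftrightarrow> s 0 = S\<^sub>0 \<and>
     (\<forall>t\<ge>0. s t \<in> V \<and> (\<exists>D\<in>V. has_network_derivative n s D t \<and> P (s t) D))"

definition converges_exponentially :: "(real \<Rightarrow> real mat) \<Rightarrow> real mat \<Rightarrow> bool" where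
  "converges_exponentially z Z \<longleftrightarrow>
     (\<exists>c\<ge>0. \<exists>\<mu>>0. \<forall>t\<ge>0. frob_norm (z t - Z) \<le> c * exp (- \<mu> * t))"

end

theory Submission
  imports Defs "HOL-Analysis.Convex"
begin

text \<open>One algorithm serves all eight structures. Introducing \<open>Y = X B\<close>, \<open>E = A Y - F\<close>, \<open>U = A\<^sup>T E\<close>, the
  normal equations become \<open>U B\<^sup>T = 0\<close>, so they form a consistent linear system in \<open>(X, Y, E, U)\<close> that
  is affine in the data. Hence it is a sum over the agents of systems built from zero-padded blocks,
  whatever the partition is. Every agent keeps a copy of all unknowns and a multiplier for each
  equation; since the range of the Laplacian of a connected graph is the set of vectors with zero sum,
  requiring that all copies agree, and that for each agent its share of the system plus the Laplacian
  of its multipliers vanishes, gives a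
  consistent system \<open>K v = b\<close> equivalent to the original one, with residuals that agents can compute
  from their neighbors' states. The gradient flow \<open>v' = - K\<^sup>T (K v - b)\<close> needs the neighbors' residuals
  too; these are exchanged through derivatives, by letting each agent integrate its own residual.
  Finally, \<open>\<parallel>K\<^sup>T K z\<parallel>\<^sup>2 \<ge> s \<parallel>K z\<parallel>\<^sup>2\<close> for some \<open>s > 0\<close> makes the residual, hence the speed of \<open>v\<close>,
  decay exponentially.\<close>

section \<open>Finite linear systems and their gradient flow\<close>

text \<open>Matrices are functions on arbitrary index sets, so that pairs (agent, variable) or (row,
  column) can serve directly as indices of a linear system.\<close>

definition lin :: "'a set \<Rightarrow> ('b \<Rightarrow> 'a \<Rightarrow> real) \<Rightarrow> ('a \<Rightarrow> real) \<Rightarrow> 'b \<Rightarrow> real" where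
  "lin I K x j = (\<Sum>i\<in>I. K j i * x i)"

definition tr :: "('b \<Rightarrow> 'a \<Rightarrow> real) \<Rightarrow> 'a \<Rightarrow> 'b \<Rightarrow> real" where
  "tr K i j = K j i"

lemma lin_cong: "(\<And>i. i \<in> I \<Longrightarrow> x i = y i) \<Longrightarrow> lin I K x j = lin I K y j"
  unfolding lin_def by (intro sum.cong) auto

lemma lin_diff: "lin I K (\<lambda>i. x i - y i) j = lin I K x j - lin I K y j"
  unfolding lin_def by (simp add: right_diff_distrib sum_subtractf)

lemma lin_adjoint:
  "(\<Sum>j\<in>J. w j * lin I K x j) = (\<Sum>i\<in>I. x i * lin J (tr K) w i)"
  unfolding lin_def tr_def sum_distrib_left
  by (subst sum.swap) (simp add: mult_ac)

text \<open>Gram--Schmidt: one column of \<open>K\<close> is added at a time; \<open>- f\<close> is its component orthogonal to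
  the previous columns.\<close>

lemma normal_equations_solvable:
  assumes "finite I" "finite J"
  shows "\<exists>x. \<forall>i\<in>I. lin J (tr K) (\<lambda>j. lin I K x j - b j) i = 0"
  using assms(1)
proof (induction I arbitrary: b rule: finite_induct)
  case empty
  then show ?case by simp
next
  case (insert s I)
  obtain y where y: "\<forall>i\<in>I. lin J (tr K) (\<lambda>j. lin I K y j - K j s) i = 0"
    using insert.IH[of "\<lambda>j. K j s"] by blast
  obtain x where x: "\<forall>i\<in>I. lin J (tr K) (\<lambda>j. lin I K x j - b j) i = 0"
    using insert.IH by blast
  define f where "f j = lin I K y j - K j s" for j
  define \<rho> where "\<rho> j = lin I K x j - b j" for j
  \<comment> \<open>Chosen so that the new residual becomes orthogonal to \<open>f\<close>. If
    \<open>f\<close> vanishes on \<open>J\<close>, division by zero gives 0 and the orthogonality is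
    trivial.\<close>
  define \<alpha> where "\<alpha> = (\<Sum>j\<in>J. f j * \<rho> j) / (\<Sum>j\<in>J. f j * f j)"
  define z where "z i = (if i = s then \<alpha> else x i - \<alpha> * y i)" for i
  have zI: "lin I K z j = lin I K x j - \<alpha> * lin I K y j" for j
  proof -
    have "lin I K z j = lin I K (\<lambda>i. x i - \<alpha> * y i) j"
      using insert.hyps by (intro lin_cong) (auto simp: z_def)
    then show ?thesis
      unfolding lin_def
      by (simp add: right_diff_distrib sum_subtractf sum_distrib_left mult_ac)
  qed
  have res: "lin (insert s I) K z j - b j = \<rho> j - \<alpha> * f j" for j
  proof -
    have "lin (insert s I) K z j = K j s * \<alpha> + lin I K z j"
      using insert.hyps by (simp add: lin_def z_def)
    then show ?thesis
      by (simp add: zI f_def \<rho>_def algebra_simps)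
  qed
  have tres: "lin J (tr K) (\<lambda>j. \<rho> j - \<alpha> * f j) i = lin J (tr K) \<rho> i - \<alpha> * lin J (tr K) f i" for i
    unfolding lin_def by (simp add: right_diff_distrib sum_subtractf sum_distrib_left mult_ac)
  have orthI: "lin J (tr K) \<rho> i = 0" "lin J (tr K) f i = 0" if "i \<in> I" for i
    using x y that by (auto simp: \<rho>_def[abs_def] f_def[abs_def])
  have f_orth: "(\<Sum>j\<in>J. f j * (\<rho> j - \<alpha> * f j)) = 0"
  proof (cases "(\<Sum>j\<in>J. f j * f j) = 0")
    case True
    then have "\<forall>j\<in>J. f j = 0"
      using assms(2) by (simp add: sum_nonneg_eq_0_iff)
    then show ?thesis by simp
  next
    case False
    have "(\<Sum>j\<in>J. f j * (\<rho> j - \<alpha> * f j)) = (\<Sum>j\<in>J. f j * \<rho> j) - \<alpha> * (\<Sum>j\<in>J. f j * f j)"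
      by (simp add: right_diff_distrib sum_subtractf sum_distrib_left mult_ac)
    then show ?thesis using False by (simp add: \<alpha>_def)
  qed
  \<comment> \<open>Column \<open>s\<close> equals \<open>lin I K y - f\<close>. The first part is a
    combination of the old columns, so the new residual is orthogonal to it as well as to
    \<open>f\<close>.\<close>
  have "(\<Sum>j\<in>J. (\<rho> j - \<alpha> * f j) * lin I K y j) = 0"
    using lin_adjoint[of "\<lambda>j. \<rho> j - \<alpha> * f j" I K y J] orthI by (simp add: tres)
  then have s_orth: "lin J (tr K) (\<lambda>j. \<rho> j - \<alpha> * f j) s = 0"
  proof -
    have "lin J (tr K) (\<lambda>j. \<rho> j - \<alpha> * f j) s =
        (\<Sum>j\<in>J. (\<rho> j - \<alpha> * f j) * lin I K y j) - (\<Sum>j\<in>J. f j * (\<rho> j - \<alpha> * f j))"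
      unfolding lin_def[of J] tr_def sum_subtractf[symmetric]
      by (intro sum.cong) (auto simp: f_def algebra_simps)
    then show ?thesis using f_orth \<open>(\<Sum>j\<in>J. (\<rho> j - \<alpha> * f j) * lin I K y j) = 0\<close> by simp
  qed
  have "\<forall>i\<in>insert s I. lin J (tr K) (\<lambda>j. lin (insert s I) K z j - b j) i = 0"
    using s_orth orthI by (simp add: res tres)
  then show ?case by blast
qed

text \<open>Pythagoras: the residual at \<open>x\<close> is orthogonal to the range of
  \<open>K\<close>, hence the cross term in the expansion around \<open>x\<close> vanishes.\<close>

lemma normal_equations_minimize:
  assumes "\<forall>i\<in>I. lin J (tr K) (\<lambda>j. lin I K x j - b j) i = 0"
  shows "(\<Sum>j\<in>J. (lin I K x j - b j)\<^sup>2) \<le> (\<Sum>j\<in>J. (lin I K y j - b j)\<^sup>2)"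
proof -
  have "(\<Sum>j\<in>J. (lin I K x j - b j) * lin I K (\<lambda>i. y i - x i) j) = 0"
    using assms by (subst lin_adjoint) simp
  moreover have "(\<Sum>j\<in>J. (lin I K y j - b j)\<^sup>2) = (\<Sum>j\<in>J. (lin I K x j - b j)\<^sup>2)
      + 2 * (\<Sum>j\<in>J. (lin I K x j - b j) * lin I K (\<lambda>i. y i - x i) j)
      + (\<Sum>j\<in>J. (lin I K (\<lambda>i. y i - x i) j)\<^sup>2)"
    unfolding sum_distrib_left sum.distrib[symmetric]
    by (intro sum.cong) (auto simp: lin_diff power2_eq_square algebra_simps)
  ultimately show ?thesis by (simp add: sum_nonneg)
qed

text \<open>By solvability of the normal equations every row of \<open>K\<close> is a combination of rows of \<open>K\<^sup>T K\<close>,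
  so Cauchy--Schwarz bounds each entry of \<open>K z\<close> by \<open>\<parallel>K\<^sup>T K z\<parallel>\<close>; no spectral theory is needed.\<close>

lemma gram_lower_bound:
  fixes K :: "'b \<Rightarrow> 'a \<Rightarrow> real"
  assumes "finite I" "finite J"
  shows "\<exists>s>0. \<forall>z. s * (\<Sum>j\<in>J. (lin I K z j)\<^sup>2) \<le> (\<Sum>i\<in>I. (lin J (tr K) (lin I K z) i)\<^sup>2)"
proof -
  \<comment> \<open>The right-hand side is the \<open>j\<close>-th unit vector; pairing its residual
    with \<open>K z\<close> recovers the single entry \<open>lin I K z j\<close> below.\<close>
  have "\<forall>j. \<exists>x. \<forall>i\<in>I. lin J (tr K) (\<lambda>j'. lin I K x j' - (if j' = j then 1 else 0)) i = 0"
    by (intro allI normal_equations_solvable assms)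
  then obtain x where x: "\<And>j i. i \<in> I \<Longrightarrow>
      lin J (tr K) (\<lambda>j'. lin I K (x j) j' - (if j' = j then 1 else 0)) i = 0"
    by metis
  define c where "c j = (\<Sum>i\<in>I. (x j i)\<^sup>2)" for j
  have c0: "c j \<ge> 0" for j by (simp add: c_def sum_nonneg)
  define g where "g z = (\<Sum>i\<in>I. (lin J (tr K) (lin I K z) i)\<^sup>2)" for z
  have g0: "g z \<ge> 0" for z by (simp add: g_def sum_nonneg)
  have entry: "(lin I K z j)\<^sup>2 \<le> c j * g z" if j: "j \<in> J" for z j
  proof -
    have "(\<Sum>j'\<in>J. (lin I K (x j) j' - (if j' = j then 1 else 0)) * lin I K z j') = 0"
      using x by (subst lin_adjoint) simp
    moreover have "(\<Sum>j'\<in>J. (if j' = j then 1 else 0) * lin I K z j') = lin I K z j"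
      using j assms(2) by (simp add: if_distrib[of "\<lambda>c. c * _"] cong: if_cong)
    ultimately have "lin I K z j = (\<Sum>j'\<in>J. lin I K z j' * lin I K (x j) j')"
      by (simp add: left_diff_distrib right_diff_distrib sum_subtractf mult.commute)
    also have "\<dots> = (\<Sum>i\<in>I. x j i * lin J (tr K) (lin I K z) i)"
      by (rule lin_adjoint)
    finally show ?thesis
      unfolding c_def g_def by (metis Cauchy_Schwarz_ineq_sum)
  qed
  \<comment> \<open>The added 1 keeps the denominator positive even if every \<open>c j\<close> is
    zero.\<close>
  define s where "s = 1 / (1 + (\<Sum>j\<in>J. c j))"
  have pos: "1 + (\<Sum>j\<in>J. c j) > 0"
    using c0 by (smt (verit) sum_nonneg)
  have "s * (\<Sum>j\<in>J. (lin I K z j)\<^sup>2) \<le> g z" for z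
  proof -
    have "(\<Sum>j\<in>J. (lin I K z j)\<^sup>2) \<le> (\<Sum>j\<in>J. c j * g z)"
      by (intro sum_mono entry)
    also have "\<dots> \<le> (1 + (\<Sum>j\<in>J. c j)) * g z"
      using g0[of z] by (simp add: sum_distrib_right distrib_right)
    finally show ?thesis
      using pos by (simp add: s_def field_simps)
  qed
  moreover have "s > 0" using pos by (simp add: s_def)
  ultimately show ?thesis unfolding g_def by blast
qed

section \<open>Scalar differential inequalities on the half-line\<close>

text \<open>At interior points the one-sided derivative is a genuine one; at 0 continuity is enough
  for the mean value argument.\<close>

lemma antimono_on_halfline:
  fixes f :: "real \<Rightarrow> real"
  assumes d: "\<And>t. t \<ge> 0 \<Longrightarrow> (f has_real_derivative f' t) (at t within {0..})"
    and le: "\<And>t. t \<ge> 0 \<Longrightarrow> f' t \<le> 0"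
    and "0 \<le> s" "s \<le> t"
  shows "f t \<le> f s"
proof (rule DERIV_nonpos_imp_decreasing_open[OF \<open>s \<le> t\<close>])
  fix x assume "s < x" "x < t"
  then have "x \<in> {0<..}" using \<open>0 \<le> s\<close> by simp
  then have "(f has_real_derivative f' x) (at x within {0<..})"
    by (intro DERIV_subset[OF d]) auto
  then have "(f has_real_derivative f' x) (at x)"
    by (simp only: at_within_open[OF \<open>x \<in> {0<..}\<close> open_greaterThan])
  then show "\<exists>y. (f has_real_derivative y) (at x) \<and> y \<le> 0"
    using le \<open>s < x\<close> \<open>0 \<le> s\<close> by force
next
  have "continuous_on {0..} f"
    using d by (auto simp: continuous_on_eq_continuous_within intro: DERIV_continuous)
  then show "continuous_on {s..t} f"
    by (rule continuous_on_subset) (use \<open>0 \<le> s\<close> in auto)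
qed

text \<open>Gronwall's argument: multiplied by the integrating factor \<open>exp (a * t)\<close>,
  the function becomes nonincreasing.\<close>

lemma exponential_decay:
  fixes f :: "real \<Rightarrow> real"
  assumes d: "\<And>t. t \<ge> 0 \<Longrightarrow> (f has_real_derivative f' t) (at t within {0..})"
    and le: "\<And>t. t \<ge> 0 \<Longrightarrow> f' t \<le> - a * f t"
    and "0 \<le> t"
  shows "f t \<le> f 0 * exp (- a * t)"
proof -
  have "((\<lambda>t. f t * exp (a * t)) has_real_derivative (f' u + a * f u) * exp (a * u)) (at u within {0..})"
    if "u \<ge> 0" for u
    using d[OF that] by (auto intro!: derivative_eq_intros simp: algebra_simps)
  then have "f t * exp (a * t) \<le> f 0 * exp (a * 0)"
  proof (rule antimono_on_halfline)
    fix u :: real assume "0 \<le> u"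
    then show "(f' u + a * f u) * exp (a * u) \<le> 0"
      using le[of u] by (intro mult_nonpos_nonneg) auto
  qed (use \<open>0 \<le> t\<close> in auto)
  then show ?thesis by (simp add: exp_minus field_simps)
qed

text \<open>Subtracting or adding \<open>c / a * exp (- a * t)\<close> gives an increasing lower and
  a decreasing upper envelope of \<open>f\<close>. The supremum of the lower one lies between both
  at all times, so the limit and the rate come from monotonicity alone.\<close>

lemma exponential_limit:
  fixes f :: "real \<Rightarrow> real"
  assumes d: "\<And>t. t \<ge> 0 \<Longrightarrow> (f has_real_derivative f' t) (at t within {0..})"
    and le: "\<And>t. t \<ge> 0 \<Longrightarrow> \<bar>f' t\<bar> \<le> c * exp (- a * t)"
    and "0 < a"
  shows "\<exists>l. \<forall>t\<ge>0. \<bar>f t - l\<bar> \<le> c / a * exp (- a * t)"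
proof -
  define lo where "lo t = f t - c / a * exp (- a * t)" for t
  define up where "up t = f t + c / a * exp (- a * t)" for t
  have c: "c \<ge> 0" using le[of 0] by simp
  have "((\<lambda>t. - lo t) has_real_derivative - (f' t + c * exp (- a * t))) (at t within {0..})"
    if "t \<ge> 0" for t
    unfolding lo_def using d[OF that] \<open>0 < a\<close> by (auto intro!: derivative_eq_intros)
  then have lo: "- lo t \<le> - lo s" if "0 \<le> s" "s \<le> t" for s t
    by (rule antimono_on_halfline) (use le that in \<open>force+\<close>)
  have "(up has_real_derivative f' t - c * exp (- a * t)) (at t within {0..})"
    if "t \<ge> 0" for t
    unfolding up_def using d[OF that] \<open>0 < a\<close> by (auto intro!: derivative_eq_intros)
  then have up: "up t \<le> up s" if "0 \<le> s" "s \<le> t" for s t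
    by (rule antimono_on_halfline) (use le that in \<open>force+\<close>)
  have lu: "lo t \<le> up t" for t
    using c \<open>0 < a\<close> by (simp add: lo_def up_def)
  have lo_up: "lo s \<le> up t" if "0 \<le> s" "0 \<le> t" for s t
    using lo[of s "max s t"] up[of t "max s t"] lu[of "max s t"] that by simp
  define l where "l = (SUP s\<in>{0..}. lo s)"
  have "bdd_above (lo ` {0..})"
    using lo_up[of _ 0] by (auto simp: bdd_above_def)
  then have 1: "lo t \<le> l" if "t \<ge> 0" for t
    unfolding l_def using that by (intro cSUP_upper) auto
  have 2: "l \<le> up t" if "t \<ge> 0" for t
    unfolding l_def using that lo_up by (intro cSUP_least) auto
  have "\<bar>f t - l\<bar> \<le> c / a * exp (- a * t)" if "t \<ge> 0" for t
    using 1[OF that] 2[OF that] unfolding lo_def up_def abs_le_iff by linarith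
  then show ?thesis by blast
qed

section \<open>Exponential convergence of the gradient flow\<close>

lemma has_derivative_lin:
  assumes "\<And>i. i \<in> I \<Longrightarrow> ((\<lambda>u. x u i) has_real_derivative x' i) (at t within S)"
  shows "((\<lambda>u. lin I K (x u) j) has_real_derivative lin I K x' j) (at t within S)"
  unfolding lin_def by (intro DERIV_sum DERIV_cmult assms)

text \<open>The squared residual is a Lyapunov function that decays exponentially by
  \<open>gram_lower_bound\<close>. The speed of \<open>v\<close> is then exponentially small, so
  \<open>v\<close> itself converges even when the system has many solutions, and the limit has zero
  residual.\<close>

lemma gradient_flow_converges:
  fixes v :: "real \<Rightarrow> 'a \<Rightarrow> real" and K :: "'b \<Rightarrow> 'a \<Rightarrow> real"
  assumes fin: "finite I" "finite J"
    and consistent: "\<forall>j\<in>J. lin I K w j = b j"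
    and flow: "\<And>t i. t \<ge> 0 \<Longrightarrow> i \<in> I \<Longrightarrow> ((\<lambda>u. v u i) has_real_derivative
      - lin J (tr K) (\<lambda>j. lin I K (v t) j - b j) i) (at t within {0..})"
  shows "\<exists>l c \<mu>. 0 < \<mu> \<and> (\<forall>j\<in>J. lin I K l j = b j) \<and>
    (\<forall>i\<in>I. \<forall>t\<ge>0. \<bar>v t i - l i\<bar> \<le> c * exp (- \<mu> * t))"
proof -
  obtain s where s: "s > 0"
    "\<And>z. s * (\<Sum>j\<in>J. (lin I K z j)\<^sup>2) \<le> (\<Sum>i\<in>I. (lin J (tr K) (lin I K z) i)\<^sup>2)"
    using gram_lower_bound[OF fin] by blast
  define e where "e t j = lin I K (v t) j - b j" for t j
  define V where "V t = (\<Sum>j\<in>J. (e t j)\<^sup>2)" for t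
  define G where "G t i = lin J (tr K) (e t) i" for t i
  have v': "((\<lambda>u. v u i) has_real_derivative - G t i) (at t within {0..})"
    if "t \<ge> 0" "i \<in> I" for t i
    using flow[OF that] unfolding G_def e_def[abs_def] by simp
  have e': "((\<lambda>u. e u j) has_real_derivative lin I K (\<lambda>i. - G t i) j) (at t within {0..})"
    if "t \<ge> 0" for t j
    unfolding e_def using that by (auto intro!: derivative_eq_intros has_derivative_lin v')
  have V': "(V has_real_derivative - 2 * (\<Sum>i\<in>I. (G t i)\<^sup>2)) (at t within {0..})"
    if "t \<ge> 0" for t
  proof -
    have "(V has_real_derivative (\<Sum>j\<in>J. 2 * (e t j * lin I K (\<lambda>i. - G t i) j))) (at t within {0..})"
      unfolding V_def by (intro DERIV_sum) (auto intro!: derivative_eq_intros e' that)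
    also have "(\<Sum>j\<in>J. 2 * (e t j * lin I K (\<lambda>i. - G t i) j)) = - 2 * (\<Sum>i\<in>I. (G t i)\<^sup>2)"
      unfolding sum_distrib_left[symmetric]
      by (subst lin_adjoint) (simp add: G_def[symmetric] G_def[symmetric, abs_def] power2_eq_square sum_negf)
    finally show ?thesis .
  qed
  \<comment> \<open>Consistency puts the residual in the range of \<open>K\<close>, where the lower
    bound on the gradient applies.\<close>
  have e_lin: "e t j = lin I K (\<lambda>i. v t i - w i) j" if "j \<in> J" for t j
    using consistent that by (simp add: e_def lin_diff)
  have "- 2 * (\<Sum>i\<in>I. (G t i)\<^sup>2) \<le> - (2 * s) * V t" for t
  proof -
    have "G t i = lin J (tr K) (lin I K (\<lambda>i. v t i - w i)) i" for i
      unfolding G_def by (intro lin_cong e_lin)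
    moreover have "V t = (\<Sum>j\<in>J. (lin I K (\<lambda>i. v t i - w i) j)\<^sup>2)"
      unfolding V_def by (intro sum.cong) (auto simp: e_lin)
    ultimately show ?thesis using s(2)[of "\<lambda>i. v t i - w i"] by simp
  qed
  then have decay: "V t \<le> V 0 * exp (- (2 * s) * t)" if "t \<ge> 0" for t
    using exponential_decay[OF V'] that by blast
  have e_bd: "\<bar>e t j\<bar> \<le> sqrt (V 0) * exp (- s * t)" if "t \<ge> 0" "j \<in> J" for t j
  proof -
    have "(e t j)\<^sup>2 \<le> V t"
      unfolding V_def using that fin by (intro member_le_sum) auto
    also have "\<dots> \<le> V 0 * exp (- (2 * s) * t)" by (rule decay[OF that(1)])
    also have "\<dots> = (sqrt (V 0) * exp (- s * t))\<^sup>2"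
      using exp_double[of "- s * t"] by (simp add: power_mult_distrib V_def sum_nonneg mult.assoc)
    finally have "\<bar>e t j\<bar> \<le> \<bar>sqrt (V 0) * exp (- s * t)\<bar>"
      by (simp only: abs_le_square_iff)
    then show ?thesis by (simp add: abs_mult V_def sum_nonneg)
  qed
  define c where "c i = (\<Sum>j\<in>J. \<bar>K j i\<bar>) * sqrt (V 0)" for i
  have G_bd: "\<bar>- G t i\<bar> \<le> c i * exp (- s * t)" if "t \<ge> 0" for t i
  proof -
    have "\<bar>G t i\<bar> \<le> (\<Sum>j\<in>J. \<bar>K j i * e t j\<bar>)"
      unfolding G_def lin_def tr_def by (rule sum_abs)
    also have "\<dots> \<le> (\<Sum>j\<in>J. \<bar>K j i\<bar> * (sqrt (V 0) * exp (- s * t)))"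
      unfolding abs_mult by (intro sum_mono mult_left_mono e_bd that) auto
    also have "\<dots> = c i * exp (- s * t)"
      by (simp add: c_def sum_distrib_right[symmetric] mult.assoc)
    finally show ?thesis by simp
  qed
  have "\<exists>l. \<forall>t\<ge>0. \<bar>v t i - l\<bar> \<le> c i / s * exp (- s * t)" if "i \<in> I" for i
    using exponential_limit[OF v' G_bd] that s(1) by blast
  then obtain l where l: "\<And>i t. i \<in> I \<Longrightarrow> t \<ge> 0 \<Longrightarrow> \<bar>v t i - l i\<bar> \<le> c i / s * exp (- s * t)"
    by metis
  have exp0: "((\<lambda>t. a * exp (- s * t)) \<longlongrightarrow> 0) at_top" for a
  proof -
    have "filterlim (\<lambda>t. - s * t) at_bot at_top"
      using s(1) by (intro filterlim_tendsto_neg_mult_at_bot[of _ "- s"] tendsto_const filterlim_ident) auto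
    then show ?thesis
      by (intro tendsto_mult_right_zero filterlim_compose[OF exp_at_bot])
  qed
  have lim_if: "(g \<longlongrightarrow> z) at_top" if "\<And>t. t \<ge> 0 \<Longrightarrow> \<bar>g t - z\<bar> \<le> a * exp (- s * t)" for g z a
  proof (rule LIM_zero_cancel, rule tendsto_0_le[OF exp0])
    show "\<forall>\<^sub>F t in at_top. norm (g t - z) \<le> norm (a * exp (- s * t)) * 1"
    proof (rule eventually_at_top_linorderI[of 0])
      fix t :: real assume "0 \<le> t"
      then show "norm (g t - z) \<le> norm (a * exp (- s * t)) * 1"
        using order_trans[OF that[OF \<open>0 \<le> t\<close>] abs_ge_self] by (simp only: real_norm_def mult_1_right)
    qed
  qed
  have lim: "((\<lambda>t. v t i) \<longlongrightarrow> l i) at_top" if "i \<in> I" for i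
    by (rule lim_if[OF l[OF that]])
  have "lin I K l j = b j" if "j \<in> J" for j
  proof (rule tendsto_unique)
    show "((\<lambda>t. lin I K (v t) j) \<longlongrightarrow> lin I K l j) at_top"
      unfolding lin_def by (intro tendsto_sum tendsto_mult tendsto_const lim)
    show "((\<lambda>t. lin I K (v t) j) \<longlongrightarrow> b j) at_top"
      by (rule lim_if) (use e_bd that in \<open>auto simp: e_def\<close>)
  qed simp
  moreover have "\<bar>v t i - l i\<bar> \<le> (\<Sum>i\<in>I. c i / s) * exp (- s * t)" if "i \<in> I" "t \<ge> 0" for i t
  proof -
    have "c i / s \<le> (\<Sum>i\<in>I. c i / s)"
      using that fin s(1) by (intro member_le_sum) (auto simp: c_def V_def sum_nonneg)
    then show ?thesis
      by (intro order_trans[OF l[OF that]] mult_right_mono) auto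
  qed
  ultimately show ?thesis using s(1) by blast
qed

section \<open>Solutions of affine differential equations\<close>

text \<open>The solution is an everywhere convergent power series in \<open>t\<close>: its
  coefficients are dominated by those of an exponential and it may be differentiated
  termwise.\<close>

lemma affine_ode_solvable:
  fixes M :: "'a \<Rightarrow> 'a \<Rightarrow> real"
  assumes fin: "finite I"
  shows "\<exists>x. (\<forall>i\<in>I. x 0 i = x0 i) \<and>
    (\<forall>t. \<forall>i\<in>I. ((\<lambda>u. x u i) has_real_derivative lin I M (x t) i + b i) (at t))"
proof -
  \<comment> \<open>Comparing powers of \<open>t\<close> in \<open>x' = M x + b\<close> gives
    \<open>(k + 1) * a (k + 1) = M (a k)\<close>, with \<open>b\<close> added only for
    \<open>k = 0\<close>.\<close>
  define a where "a = rec_nat x0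
    (\<lambda>k y i. (lin I M y i + (if k = 0 then b i else 0)) / real (Suc k))"
  have a_0: "a 0 = x0"
    and a_Suc: "a (Suc k) i = (lin I M (a k) i + (if k = 0 then b i else 0)) / real (Suc k)" for k i
    by (simp_all add: a_def)
  define B where "B = (\<Sum>i\<in>I. \<bar>x0 i\<bar>) + (\<Sum>i\<in>I. \<bar>b i\<bar>)"
  define m where "m = (\<Sum>i\<in>I. \<Sum>j\<in>I. \<bar>M i j\<bar>)"
  have m: "(\<Sum>j\<in>I. \<bar>M i j\<bar>) \<le> m" if "i \<in> I" for i
    unfolding m_def using that fin by (intro member_le_sum) (auto simp: sum_nonneg)
  have m0: "m \<ge> 0" by (simp add: m_def sum_nonneg)
  have B: "\<bar>x0 i\<bar> \<le> B" "\<bar>b i\<bar> \<le> B" if "i \<in> I" for i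
  proof -
    have "\<bar>x0 i\<bar> \<le> (\<Sum>i\<in>I. \<bar>x0 i\<bar>)" "\<bar>b i\<bar> \<le> (\<Sum>i\<in>I. \<bar>b i\<bar>)"
      using that fin by (auto intro!: member_le_sum)
    moreover have "0 \<le> (\<Sum>i\<in>I. \<bar>x0 i\<bar>)" "0 \<le> (\<Sum>i\<in>I. \<bar>b i\<bar>)" by (auto intro: sum_nonneg)
    ultimately show "\<bar>x0 i\<bar> \<le> B" "\<bar>b i\<bar> \<le> B" by (auto simp: B_def)
  qed
  have B0: "B \<ge> 0" by (simp add: B_def sum_nonneg)
  \<comment> \<open>The 1 in \<open>m + 1\<close> absorbs the inhomogeneous term \<open>b\<close>,
    itself bounded by \<open>B\<close>.\<close>
  have bd: "\<bar>a k i\<bar> \<le> B * ((m + 1) ^ k / fact k)" if "i \<in> I" for k i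
    using that
  proof (induction k arbitrary: i)
    case 0
    then show ?case using B by (simp add: a_0)
  next
    case (Suc k)
    define \<beta> where "\<beta> = B * ((m + 1) ^ k / fact k)"
    have \<beta>0: "\<beta> \<ge> 0" using B0 m0 by (simp add: \<beta>_def)
    have "\<bar>lin I M (a k) i\<bar> \<le> (\<Sum>j\<in>I. \<bar>M i j\<bar> * \<bar>a k j\<bar>)"
      unfolding lin_def abs_mult[symmetric] by (rule sum_abs)
    also have "\<dots> \<le> (\<Sum>j\<in>I. \<bar>M i j\<bar> * \<beta>)"
      unfolding \<beta>_def by (intro sum_mono mult_left_mono Suc.IH) auto
    also have "\<dots> \<le> m * \<beta>"
      unfolding sum_distrib_right[symmetric] by (intro mult_right_mono m Suc.prems \<beta>0)
    finally have "\<bar>lin I M (a k) i\<bar> \<le> m * \<beta>" .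
    moreover have "\<bar>if k = 0 then b i else 0\<bar> \<le> \<beta>"
      using \<beta>0 B(2)[OF Suc.prems] by (auto simp: \<beta>_def)
    ultimately have "\<bar>lin I M (a k) i + (if k = 0 then b i else 0)\<bar> \<le> (m + 1) * \<beta>"
      unfolding distrib_right mult_1 by linarith
    then have "\<bar>a (Suc k) i\<bar> \<le> (m + 1) * \<beta> / real (Suc k)"
      unfolding a_Suc abs_divide by (simp add: divide_right_mono)
    then show ?case by (simp add: \<beta>_def field_simps)
  qed
  have smm: "summable (\<lambda>k. a k i * t ^ k)" if "i \<in> I" for i t
  proof (rule summable_comparison_test')
    show "summable (\<lambda>k. B * (inverse (fact k) * ((m + 1) * \<bar>t\<bar>) ^ k))"
      by (intro summable_mult summable_exp)
    show "norm (a k i * t ^ k) \<le> B * (inverse (fact k) * ((m + 1) * \<bar>t\<bar>) ^ k)" if "k \<ge> 0" for k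
    proof -
      have "\<bar>a k i\<bar> * \<bar>t\<bar> ^ k \<le> B * ((m + 1) ^ k / fact k) * \<bar>t\<bar> ^ k"
        by (intro mult_right_mono bd \<open>i \<in> I\<close>) auto
      then show ?thesis
        by (simp add: abs_mult power_abs power_mult_distrib divide_inverse mult_ac)
    qed
  qed
  define x where "x t i = (\<Sum>k. a k i * t ^ k)" for t i
  have "((\<lambda>u. x u i) has_real_derivative lin I M (x t) i + b i) (at t)" if i: "i \<in> I" for t i
  proof -
    have "((\<lambda>u. x u i) has_real_derivative (\<Sum>k. diffs (\<lambda>k. a k i) k * t ^ k)) (at t)"
      unfolding x_def using termdiffs_strong_converges_everywhere[OF smm[OF i]] .
    moreover have "(\<lambda>k. diffs (\<lambda>k. a k i) k * t ^ k) sums (lin I M (x t) i + b i)"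
    proof -
      have "(\<lambda>k. \<Sum>j\<in>I. M i j * (a k j * t ^ k)) sums lin I M (x t) i"
        unfolding lin_def x_def by (intro sums_sum sums_mult summable_sums smm)
      moreover have "(\<lambda>k. if k = 0 then b i else 0) sums b i"
        by (rule sums_single)
      ultimately have "(\<lambda>k. (\<Sum>j\<in>I. M i j * (a k j * t ^ k)) + (if k = 0 then b i else 0)) sums
          (lin I M (x t) i + b i)"
        by (rule sums_add)
      also have "(\<lambda>k. (\<Sum>j\<in>I. M i j * (a k j * t ^ k)) + (if k = 0 then b i else 0)) =
          (\<lambda>k. diffs (\<lambda>k. a k i) k * t ^ k)"
        by (auto simp: fun_eq_iff diffs_def a_Suc lin_def sum_distrib_left sum_distrib_right distrib_right mult_ac
            simp del: of_nat_Suc)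
      finally show ?thesis .
    qed
    ultimately show ?thesis using sums_unique by metis
  qed
  moreover have "x 0 i = x0 i" for i
    by (simp add: x_def a_0)
  ultimately show ?thesis by blast
qed

section \<open>Operator and Frobenius norm bounds\<close>

text \<open>The sum of all absolute entries bounds the operator in the maximum norm; the Lipschitz
  constant of the network is built from two such bounds.\<close>

lemma lin_bounded:
  assumes "finite I" "finite J"
  shows "\<exists>\<kappa>\<ge>0. \<forall>x d. 0 \<le> d \<longrightarrow> (\<forall>i\<in>I. \<bar>x i\<bar> \<le> d) \<longrightarrow> (\<forall>j\<in>J. \<bar>lin I K x j\<bar> \<le> \<kappa> * d)"
proof (intro exI conjI allI impI ballI)
  let ?\<kappa> = "\<Sum>j\<in>J. \<Sum>i\<in>I. \<bar>K j i\<bar>"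
  show "?\<kappa> \<ge> 0" by (simp add: sum_nonneg)
  fix x d j assume d: "0 \<le> (d::real)" and x: "\<forall>i\<in>I. \<bar>x i\<bar> \<le> d" and j: "j \<in> J"
  have "\<bar>lin I K x j\<bar> \<le> (\<Sum>i\<in>I. \<bar>K j i\<bar> * \<bar>x i\<bar>)"
    unfolding lin_def abs_mult[symmetric] by (rule sum_abs)
  also have "\<dots> \<le> (\<Sum>i\<in>I. \<bar>K j i\<bar> * d)"
    using x by (intro sum_mono mult_left_mono) auto
  also have "\<dots> \<le> ?\<kappa> * d"
    unfolding sum_distrib_right[symmetric] using j d assms
    by (intro mult_right_mono member_le_sum[of j J "\<lambda>j. \<Sum>i\<in>I. \<bar>K j i\<bar>"]) (auto simp: sum_nonneg)
  finally show "\<bar>lin I K x j\<bar> \<le> ?\<kappa> * d" .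
qed

lemma frob_norm_sq: "(frob_norm M)\<^sup>2 = (\<Sum>a<dim_row M. \<Sum>b<dim_col M. (M $$ (a, b))\<^sup>2)"
  unfolding frob_norm_def by (simp add: sum_nonneg)

lemma frob_norm_le:
  assumes "\<And>a b. a < dim_row M \<Longrightarrow> b < dim_col M \<Longrightarrow> \<bar>M $$ (a, b)\<bar> \<le> d" and "0 \<le> d"
  shows "frob_norm M \<le> sqrt (real (dim_row M * dim_col M)) * d"
proof -
  have "(\<Sum>a<dim_row M. \<Sum>b<dim_col M. (M $$ (a, b))\<^sup>2) \<le> (\<Sum>a<dim_row M. \<Sum>b<dim_col M. d\<^sup>2)"
    using assms by (intro sum_mono) (auto simp: abs_le_square_iff[symmetric])
  then have "frob_norm M \<le> sqrt (real (dim_row M * dim_col M) * d\<^sup>2)"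
    unfolding frob_norm_def by (simp add: mult.assoc)
  then show ?thesis using assms(2) by (simp add: real_sqrt_mult)
qed

lemma entry_le_frob_norm:
  assumes "a < dim_row M" "b < dim_col M"
  shows "\<bar>M $$ (a, b)\<bar> \<le> frob_norm M"
proof -
  have "(M $$ (a, b))\<^sup>2 \<le> (\<Sum>b<dim_col M. (M $$ (a, b))\<^sup>2)"
    using assms by (intro member_le_sum) auto
  also have "\<dots> \<le> (frob_norm M)\<^sup>2"
    unfolding frob_norm_sq using assms
    by (intro member_le_sum[of a "{..<dim_row M}" "\<lambda>a. \<Sum>b<dim_col M. (M $$ (a, b))\<^sup>2"])
       (auto simp: sum_nonneg)
  finally have "\<bar>M $$ (a, b)\<bar> \<le> \<bar>frob_norm M\<bar>"
    by (simp only: abs_le_square_iff)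
  then show ?thesis by (simp add: frob_norm_def sum_nonneg)
qed

lemma scalar_prod_self: "scalar_prod v v = (\<Sum>k<dim_vec v. (v $ k :: real)\<^sup>2)"
  by (simp add: scalar_prod_def power2_eq_square atLeast0LessThan)

section \<open>Graph Laplacians\<close>

locale weighted_graph =
  fixes n :: nat and G :: "nat pair_pre_digraph" and W :: "real mat"
  assumes connected_graph: "connected_graph_on n G"
    and adjacency: "weighted_adjacency n G W"
begin

definition lap :: "(nat \<Rightarrow> real) \<Rightarrow> nat \<Rightarrow> real" where
  "lap x i = (\<Sum>j<n. W $$ (i, j) * (x i - x j))"

lemma dims: "dim_row W = n" "dim_col W = n"
  using adjacency by (auto simp: weighted_adjacency_def)

lemma W_sym: "i < n \<Longrightarrow> j < n \<Longrightarrow> W $$ (i, j) = W $$ (j, i)"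
  using adjacency by (auto simp: weighted_adjacency_def)

lemma W_nonneg: "i < n \<Longrightarrow> j < n \<Longrightarrow> W $$ (i, j) \<ge> 0"
  using adjacency by (fastforce simp: weighted_adjacency_def split: if_splits)

lemma W_arc: "i < n \<Longrightarrow> j < n \<Longrightarrow> (i, j) \<in> parcs G \<Longrightarrow> W $$ (i, j) > 0"
  using adjacency by (auto simp: weighted_adjacency_def split: if_splits)

lemma W_no_arc: "i < n \<Longrightarrow> j < n \<Longrightarrow> (i, j) \<notin> parcs G \<Longrightarrow> W $$ (i, j) = 0"
  using adjacency by (auto simp: weighted_adjacency_def split: if_splits)

lemma constant_if_constant_on_arcs:
  assumes x: "\<And>i j. i < n \<Longrightarrow> j < n \<Longrightarrow> (i, j) \<in> parcs G \<Longrightarrow> x i = x j"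
    and "i < n" "j < n"
  shows "x i = x j"
proof -
  interpret pair_graph G
    using connected_graph by (simp add: connected_graph_on_def)
  have V: "pverts G = {..<n}"
    using connected_graph by (simp add: connected_graph_on_def)
  have "i \<rightarrow>\<^sup>*\<^bsub>mk_symmetric (with_proj G)\<^esub> j"
    using connected_graph assms
    by (auto simp: connected_graph_on_def connected_def strongly_connected_def)
  \<comment> \<open>Connectedness refers to the symmetric closure, which has the same reachability
    because the arcs are already symmetric.\<close>
  then have "i \<rightarrow>\<^sup>*\<^bsub>with_proj G\<^esub> j"
    by (simp only: reachable_mk_symmetric_eq[OF sym_arcs])
  then show ?thesis
  proof (induction rule: reachable_induct)
    case base
    show ?case by simp
  next
    case (step k l)
    then have "(k, l) \<in> parcs G" by (auto simp: arcs_ends_def arc_to_ends_def)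
    moreover have "k < n" "l < n"
      using in_arcsD1[OF \<open>(k, l) \<in> parcs G\<close>] in_arcsD2[OF \<open>(k, l) \<in> parcs G\<close>] V by simp_all
    ultimately show ?case using x[of k l] step.IH by simp
  qed
qed

section \<open>Kernel and range of the Laplacian\<close>

lemma sum_lap: "(\<Sum>i<n. lap x i) = 0"
proof -
  have "(\<Sum>i<n. lap x i) = (\<Sum>i<n. \<Sum>j<n. W $$ (i, j) * x i) - (\<Sum>i<n. \<Sum>j<n. W $$ (i, j) * x j)"
    by (simp add: lap_def right_diff_distrib sum_subtractf)
  also have "(\<Sum>i<n. \<Sum>j<n. W $$ (i, j) * x j) = (\<Sum>i<n. \<Sum>j<n. W $$ (i, j) * x i)"
    by (subst sum.swap) (auto intro!: sum.cong simp: W_sym)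
  finally show ?thesis by simp
qed

text \<open>Exchanging the two summation indices and averaging both forms produces the squares; the
  division by 2 comes from this averaging.\<close>

lemma lap_energy: "(\<Sum>i<n. x i * lap x i) = (\<Sum>i<n. \<Sum>j<n. W $$ (i, j) * (x i - x j)\<^sup>2) / 2"
proof -
  have "(\<Sum>i<n. x i * lap x i) = (\<Sum>i<n. \<Sum>j<n. W $$ (i, j) * (x i * (x i - x j)))" (is "_ = ?a")
    by (simp add: lap_def sum_distrib_left mult_ac)
  moreover have "?a = (\<Sum>i<n. \<Sum>j<n. W $$ (i, j) * (x j * (x j - x i)))"
    by (subst sum.swap) (auto intro!: sum.cong simp: W_sym)
  ultimately have "2 * (\<Sum>i<n. x i * lap x i) = (\<Sum>i<n. \<Sum>j<n. W $$ (i, j) * (x i * (x i - x j)))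
      + (\<Sum>i<n. \<Sum>j<n. W $$ (i, j) * (x j * (x j - x i)))"
    by simp
  also have "\<dots> = (\<Sum>i<n. \<Sum>j<n. W $$ (i, j) * (x i - x j)\<^sup>2)"
    unfolding sum.distrib[symmetric]
    by (intro sum.cong) (auto simp: power2_eq_square algebra_simps)
  finally show ?thesis by simp
qed

text \<open>The energy vanishes, and all its terms are nonnegative, so \<open>x\<close> agrees
  across every arc; connectedness spreads this to all agents.\<close>

lemma lap_eq_0_imp_constant:
  assumes "\<And>i. i < n \<Longrightarrow> lap x i = 0" and "i < n" "j < n"
  shows "x i = x j"
proof (rule constant_if_constant_on_arcs[of x, OF _ assms(2,3)])
  fix i j assume ij: "i < n" "j < n" "(i, j) \<in> parcs G"
  have nonneg: "0 \<le> W $$ (i, j) * (x i - x j)\<^sup>2" if "i < n" "j < n" for i j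
    using W_nonneg that by simp
  have "(\<Sum>i<n. \<Sum>j<n. W $$ (i, j) * (x i - x j)\<^sup>2) = 0"
    using lap_energy[of x] assms(1) by simp
  then have "(\<Sum>j<n. W $$ (i, j) * (x i - x j)\<^sup>2) = 0"
    using ij nonneg by (subst (asm) sum_nonneg_eq_0_iff) (auto intro!: sum_nonneg)
  then have "W $$ (i, j) * (x i - x j)\<^sup>2 = 0"
    using ij nonneg by (subst (asm) sum_nonneg_eq_0_iff) auto
  then show "x i = x j" using W_arc[OF ij] by simp
qed

text \<open>Degree matrix minus adjacency matrix, the form in which the Laplacian can be passed to
  \<open>lin\<close>.\<close>

definition lap_mat :: "nat \<Rightarrow> nat \<Rightarrow> real" where
  "lap_mat i j = (if i = j then \<Sum>l<n. W $$ (i, l) else 0) - W $$ (i, j)"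

lemma sum_lap_mat: "i < n \<Longrightarrow> (\<Sum>j<n. lap_mat i j * x j) = lap x i"
  by (simp add: lap_mat_def lap_def left_diff_distrib right_diff_distrib sum_subtractf
      sum_distrib_right if_distrib[of "\<lambda>c. c * _"] cong: if_cong)

lemma lap_mat_sym: "i < n \<Longrightarrow> j < n \<Longrightarrow> lap_mat i j = lap_mat j i"
  by (simp add: lap_mat_def W_sym)

text \<open>A least squares residual lies in the kernel of the transpose, here the Laplacian itself,
  so it is constant. It also has zero sum, and therefore vanishes.\<close>

lemma lap_solvable:
  assumes "(\<Sum>i<n. b i) = 0"
  shows "\<exists>x. \<forall>i<n. lap x i = b i"
proof -
  obtain x where x: "\<forall>i\<in>{..<n}. lin {..<n} (tr lap_mat) (\<lambda>j. lin {..<n} lap_mat x j - b j) i = 0"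
    using normal_equations_solvable[of "{..<n}" "{..<n}"] by blast
  have "lap (\<lambda>j. lap x j - b j) i = 0" if "i < n" for i
  proof -
    have "lap (\<lambda>j. lap x j - b j) i = (\<Sum>j<n. lap_mat j i * (lap x j - b j))"
      using that by (simp add: sum_lap_mat[symmetric] lap_mat_sym)
    then show ?thesis
      using x that by (simp add: lin_def tr_def sum_lap_mat)
  qed
  note const = lap_eq_0_imp_constant[OF this]
  have "lap x i = b i" if "i < n" for i
  proof -
    have "(\<Sum>j<n. lap x j - b j) = 0"
      by (simp add: sum_subtractf sum_lap assms)
    moreover have "(\<Sum>j<n. lap x j - b j) = (\<Sum>j<n. lap x i - b i)"
      by (rule sum.cong[OF refl], rule const) (use that in simp_all)
    ultimately show ?thesis using that by simp
  qed
  then show ?thesis by blast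
qed

end

section \<open>Distributed gradient flow\<close>

text \<open>The auxiliary vector has length \<open>2 N\<close>: its first half are the variables, its second half
  integrates the residual. In the derivative \<open>ds\<close> that half therefore is the residual itself, which is
  how the residuals of neighbors enter the gradient. The variable with index \<open>pos i ab\<close> is
  tracked by entry \<open>ab\<close> of the estimate; because its derivative is fed forward, the tracking error
  obeys \<open>\<delta>' = - \<delta>\<close>.\<close>

definition agent_rule ::
  "nat \<Rightarrow> nat \<Rightarrow> (nat \<Rightarrow> nat) \<Rightarrow> (nat \<Rightarrow> nat) \<Rightarrow> (nat \<Rightarrow> nat \<times> nat \<Rightarrow> nat) \<Rightarrow>
   (nat \<Rightarrow> data \<Rightarrow> nat \<Rightarrow> nat \<Rightarrow> real) \<Rightarrow> (nat \<Rightarrow> data \<Rightarrow> nat \<Rightarrow> real) \<Rightarrow> algorithm" where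
  "agent_rule n N rd cd pos T c i w d s ds nb =
     (mat (rd i) (cd i) (\<lambda>ab. snd ds $ pos i ab + snd s $ pos i ab - fst s $$ ab),
      vec (2 * N) (\<lambda>k.
        if k < N then
          - ((\<Sum>e<N. T i d e k * snd ds $ (N + e)) +
             (\<Sum>j<n. case nb j of None \<Rightarrow> 0
                | Some (sj, dsj) \<Rightarrow> w $ j * (snd ds $ (N + k) - snd dsj $ (N + k))))
        else
          (\<Sum>l<N. T i d (k - N) l * snd s $ l) +
          (\<Sum>j<n. case nb j of None \<Rightarrow> 0
             | Some (sj, dsj) \<Rightarrow> w $ j * (snd s $ (k - N) - snd sj $ (k - N))) -
          c i d (k - N)))"

text \<open>\<open>T i d\<close> and \<open>c i d\<close> are the coefficients and right-hand side
  of agent \<open>i\<close>, with its data as argument \<open>d\<close>, so that the rule itself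
  never mentions \<open>dat\<close>. Each agent has as many equations as variables, which lets
  multipliers carry the index of their equation.\<close>

locale linear_network = weighted_graph +
  fixes N :: nat and rd cd :: "nat \<Rightarrow> nat" and pos :: "nat \<Rightarrow> nat \<times> nat \<Rightarrow> nat"
    and T :: "nat \<Rightarrow> data \<Rightarrow> nat \<Rightarrow> nat \<Rightarrow> real" and c :: "nat \<Rightarrow> data \<Rightarrow> nat \<Rightarrow> real"
    and dat :: "nat \<Rightarrow> data"
  assumes pos: "\<And>i a b. i < n \<Longrightarrow> a < rd i \<Longrightarrow> b < cd i \<Longrightarrow> pos i (a, b) < N"
begin

definition I :: "(nat \<times> nat) set" where
  "I = {..<n} \<times> {..<N}"

lemma finite_I: "finite I" by (simp add: I_def)

text \<open>The block-diagonal matrix of the local systems plus the Kronecker product of the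
  Laplacian with the identity of size \<open>N\<close>.\<close>

definition K :: "nat \<times> nat \<Rightarrow> nat \<times> nat \<Rightarrow> real" where
  "K = (\<lambda>(i, e) (j, k). (if i = j then T i (dat i) e k else 0) + (if e = k then lap_mat i j else 0))"

definition rhs :: "nat \<times> nat \<Rightarrow> real" where
  "rhs = (\<lambda>(i, e). c i (dat i) e)"

lemma sum_I: "(\<Sum>z\<in>I. f z) = (\<Sum>j<n. \<Sum>k<N. f (j, k))"
  unfolding I_def by (simp add: sum.cartesian_product)

lemma sum_block_lap:
  assumes "i < n" "e < N"
  shows "(\<Sum>j<n. \<Sum>k<N. ((if i = j then t k else 0) + (if e = k then lap_mat i j else 0)) * v (j, k)) =
    (\<Sum>k<N. t k * v (i, k)) + lap (\<lambda>j. v (j, e)) i"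
proof -
  have "(\<Sum>k<N. (if e = k then lap_mat i j else 0) * v (j, k)) = lap_mat i j * v (j, e)" for j
    using assms by (simp add: if_distrib[of "\<lambda>c. c * _"] cong: if_cong)
  moreover have "(\<Sum>j<n. \<Sum>k<N. (if i = j then t k else 0) * v (j, k)) =
      (\<Sum>j<n. if i = j then \<Sum>k<N. t k * v (j, k) else 0)"
    by (intro sum.cong) auto
  ultimately show ?thesis
    using assms by (simp add: distrib_right sum.distrib sum_lap_mat)
qed

lemma lin_K:
  assumes "i < n" "e < N"
  shows "lin I K v (i, e) = (\<Sum>k<N. T i (dat i) e k * v (i, k)) + lap (\<lambda>j. v (j, e)) i"
  unfolding lin_def sum_I K_def using sum_block_lap[OF assms] by simp

text \<open>Symmetry of the Laplacian keeps the transpose as local as \<open>K\<close>: the gradient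
  of agent \<open>i\<close> involves its own block and the residuals of its neighbors only.\<close>

lemma lin_tr_K:
  assumes "i < n" "k < N"
  shows "lin I (tr K) w (i, k) = (\<Sum>e<N. T i (dat i) e k * w (i, e)) + lap (\<lambda>j. w (j, k)) i"
proof -
  have "lin I (tr K) w (i, k) = (\<Sum>j<n. \<Sum>e<N.
      ((if i = j then T i (dat i) e k else 0) + (if k = e then lap_mat i j else 0)) * w (j, e))"
    unfolding lin_def sum_I K_def tr_def using assms
    by (intro sum.cong) (auto simp: lap_mat_sym)
  then show ?thesis using sum_block_lap[OF assms] by simp
qed

section \<open>From the implicit rule to an explicit vector field\<close>

definition V :: "(nat \<Rightarrow> state) set" where
  "V = network_states n (\<lambda>i. carrier_mat (rd i) (cd i)) (\<lambda>_. 2 * N)"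

definition P :: "(nat \<Rightarrow> state) \<Rightarrow> (nat \<Rightarrow> state) \<Rightarrow> bool" where
  "P = obeys_rules n G W dat (agent_rule n N rd cd pos T c)"

definition var :: "(nat \<Rightarrow> state) \<Rightarrow> nat \<times> nat \<Rightarrow> real" where
  "var S = (\<lambda>(i, k). snd (S i) $ k)"

definition acc :: "(nat \<Rightarrow> state) \<Rightarrow> nat \<times> nat \<Rightarrow> real" where
  "acc S = (\<lambda>(i, k). snd (S i) $ (N + k))"

definition res :: "(nat \<Rightarrow> state) \<Rightarrow> nat \<times> nat \<Rightarrow> real" where
  "res S j = lin I K (var S) j - rhs j"

definition grad :: "(nat \<Rightarrow> state) \<Rightarrow> nat \<times> nat \<Rightarrow> real" where
  "grad S = lin I (tr K) (res S)"

text \<open>The candidate for \<open>\<phi>\<close> in \<open>lipschitz_ode\<close>;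
  \<open>restrict\<close> makes it extensional, as membership in \<open>V\<close> demands.\<close>

definition field :: "(nat \<Rightarrow> state) \<Rightarrow> nat \<Rightarrow> state" where
  "field S = restrict (\<lambda>i.
     (mat (rd i) (cd i) (\<lambda>ab. - grad S (i, pos i ab) + var S (i, pos i ab) - fst (S i) $$ ab),
      vec (2 * N) (\<lambda>k. if k < N then - grad S (i, k) else res S (i, k - N)))) {..<n}"

lemma V_D:
  assumes "S \<in> V"
  shows "i < n \<Longrightarrow> dim_row (fst (S i)) = rd i" "i < n \<Longrightarrow> dim_col (fst (S i)) = cd i"
    "i < n \<Longrightarrow> dim_vec (snd (S i)) = 2 * N" "\<not> i < n \<Longrightarrow> S i = undefined"
  using assms unfolding V_def network_states_def
  by (auto simp: PiE_def Pi_def extensional_def mem_Times_iff)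

lemma V_I:
  assumes "\<And>i. i < n \<Longrightarrow> fst (S i) \<in> carrier_mat (rd i) (cd i)"
    "\<And>i. i < n \<Longrightarrow> snd (S i) \<in> carrier_vec (2 * N)" "\<And>i. \<not> i < n \<Longrightarrow> S i = undefined"
  shows "S \<in> V"
  using assms unfolding V_def network_states_def
  by (auto simp: PiE_def Pi_def extensional_def mem_Times_iff)

lemma V_eqI:
  assumes "S \<in> V" "S' \<in> V"
    and "\<And>i a b. i < n \<Longrightarrow> a < rd i \<Longrightarrow> b < cd i \<Longrightarrow> fst (S i) $$ (a, b) = fst (S' i) $$ (a, b)"
    and "\<And>i k. i < n \<Longrightarrow> k < N \<Longrightarrow> var S (i, k) = var S' (i, k)"
    and "\<And>i k. i < n \<Longrightarrow> k < N \<Longrightarrow> acc S (i, k) = acc S' (i, k)"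
  shows "S = S'"
proof
  fix i
  show "S i = S' i"
  proof (cases "i < n")
    case True
    have "fst (S i) = fst (S' i)"
      using True assms(1-3) by (intro eq_matI) (auto simp: V_D)
    moreover have "snd (S i) = snd (S' i)"
    proof (rule eq_vecI)
      fix k assume "k < dim_vec (snd (S' i))"
      then show "snd (S i) $ k = snd (S' i) $ k"
        using assms(4)[OF True, of k] assms(5)[OF True, of "k - N"] True V_D(3)[OF assms(2)]
        by (cases "k < N") (auto simp: var_def acc_def)
    qed (use True assms in \<open>auto simp: V_D\<close>)
    ultimately show ?thesis by (simp add: prod_eq_iff)
  qed (use assms in \<open>auto simp: V_D\<close>)
qed

lemma field_V: "field S \<in> V"
  by (rule V_I) (auto simp: field_def)

lemma fst_field:
  "i < n \<Longrightarrow> a < rd i \<Longrightarrow> b < cd i \<Longrightarrow> fst (field S i) $$ (a, b) =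
    - grad S (i, pos i (a, b)) + var S (i, pos i (a, b)) - fst (S i) $$ (a, b)"
  by (simp add: field_def)

lemma snd_field:
  "i < n \<Longrightarrow> k < 2 * N \<Longrightarrow> snd (field S i) $ k = (if k < N then - grad S (i, k) else res S (i, k - N))"
  by (simp add: field_def)

lemma var_field: "i < n \<Longrightarrow> k < N \<Longrightarrow> var (field S) (i, k) = - grad S (i, k)"
  by (simp add: field_def var_def)

lemma acc_field: "i < n \<Longrightarrow> k < N \<Longrightarrow> acc (field S) (i, k) = res S (i, k)"
  by (simp add: field_def acc_def)

text \<open>Weights vanish off the arcs, so what an agent can sum over its neighbors is a sum over
  all agents, as in \<open>lap\<close>.\<close>

lemma neighbor_sum:
  assumes "i < n"
  shows "(\<Sum>j<n. case (if (i, j) \<in> parcs G then Some (S j, E j) else None) of None \<Rightarrow> 0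
      | Some (sj, dsj) \<Rightarrow> row W i $ j * f sj dsj) = (\<Sum>j<n. W $$ (i, j) * f (S j) (E j))"
  using assms by (intro sum.cong) (auto simp: W_no_arc dims)

lemma agent_rule_eq:
  assumes "i < n"
  shows "agent_rule n N rd cd pos T c i (row W i) (dat i) (S i) (E i)
      (\<lambda>j. if (i, j) \<in> parcs G then Some (S j, E j) else None) =
    (mat (rd i) (cd i) (\<lambda>ab. var E (i, pos i ab) + var S (i, pos i ab) - fst (S i) $$ ab),
     vec (2 * N) (\<lambda>k. if k < N then - lin I (tr K) (acc E) (i, k) else res S (i, k - N)))"
  unfolding agent_rule_def
    neighbor_sum[OF assms, where f = "\<lambda>sj dsj. snd (E i) $ (N + k) - snd dsj $ (N + k)" for k]
    neighbor_sum[OF assms, where f = "\<lambda>sj dsj. snd (S i) $ k - snd sj $ k" for k]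
  using assms by (auto simp: var_def acc_def res_def rhs_def lin_K lin_tr_K lap_def)

text \<open>The implicit equations are triangular: accumulator derivatives depend on the state
  alone, they determine the derivatives of the variables, and these in turn determine those of the
  estimates.\<close>

lemma P_iff:
  assumes "E \<in> V"
  shows "P S E \<longleftrightarrow> E = field S"
proof -
  have grad: "lin I (tr K) (acc E) j = grad S j"
    if "\<And>i k. i < n \<Longrightarrow> k < N \<Longrightarrow> acc E (i, k) = res S (i, k)" for j
    unfolding grad_def by (rule lin_cong) (use that in \<open>auto simp: I_def\<close>)
  have "E = field S" if "P S E"
  proof -
    have E: "E i = (mat (rd i) (cd i) (\<lambda>ab. var E (i, pos i ab) + var S (i, pos i ab) - fst (S i) $$ ab),
        vec (2 * N) (\<lambda>k. if k < N then - lin I (tr K) (acc E) (i, k) else res S (i, k - N)))"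
      (is "_ = ?E i") if "i < n" for i
      using \<open>P S E\<close> agent_rule_eq[OF that, of S E] that unfolding P_def obeys_rules_def by simp
    have acc: "acc E (i, k) = res S (i, k)" if "i < n" "k < N" for i k
    proof -
      have "acc E (i, k) = snd (?E i) $ (N + k)"
        using E[OF that(1)] by (simp only: acc_def case_prod_conv)
      then show ?thesis using that by simp
    qed
    have var: "var E (i, k) = - grad S (i, k)" if "i < n" "k < N" for i k
    proof -
      have "var E (i, k) = snd (?E i) $ k"
        using E[OF that(1)] by (simp only: var_def case_prod_conv)
      then show ?thesis using that by (simp add: grad[OF acc])
    qed
    show "E = field S"
    proof (rule V_eqI[OF assms field_V])
      fix i a b assume *: "i < n" "a < rd i" "b < cd i"
      have "fst (E i) $$ (a, b) = fst (?E i) $$ (a, b)"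
        by (simp only: E[OF *(1)])
      then show "fst (E i) $$ (a, b) = fst (field S i) $$ (a, b)"
        using * pos by (simp add: fst_field var)
    qed (simp_all add: var_field acc_field acc var)
  qed
  moreover have "P S (field S)"
    unfolding P_def obeys_rules_def
  proof (intro allI impI)
    fix i assume i: "i < n"
    have acc: "lin I (tr K) (acc (field S)) j = grad S j" for j
      unfolding grad_def by (rule lin_cong) (auto simp: I_def acc_field)
    show "field S i = agent_rule n N rd cd pos T c i (row W i) (dat i) (S i) (field S i)
       (\<lambda>j. if (i, j) \<in> parcs G then Some (S j, field S j) else None)"
      unfolding agent_rule_eq[OF i] acc
    proof (rule prod_eqI)
      show "fst (field S i) = fst (mat (rd i) (cd i)
          (\<lambda>ab. var (field S) (i, pos i ab) + var S (i, pos i ab) - fst (S i) $$ ab),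
        vec (2 * N) (\<lambda>k. if k < N then - grad S (i, k) else res S (i, k - N)))"
        using i pos V_D(1,2)[OF field_V i] by (intro eq_matI) (auto simp: fst_field var_field)
    qed (use i in \<open>simp add: field_def\<close>)
  qed
  ultimately show ?thesis by blast
qed

section \<open>Lipschitz continuity of the vector field\<close>

lemma network_dist_sq:
  assumes "S \<in> V" "S' \<in> V"
  shows "network_dist n S S' = sqrt (\<Sum>i<n. (frob_norm (fst (S i) - fst (S' i)))\<^sup>2 +
    (\<Sum>k<2 * N. (snd (S i) $ k - snd (S' i) $ k)\<^sup>2))"
  unfolding network_dist_def scalar_prod_self
  using assms by (intro arg_cong[of _ _ sqrt] sum.cong) (auto simp: V_D)

lemma node_le_network_dist:
  assumes "S \<in> V" "S' \<in> V" "i < n"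
  shows "(frob_norm (fst (S i) - fst (S' i)))\<^sup>2 + (\<Sum>k<2 * N. (snd (S i) $ k - snd (S' i) $ k)\<^sup>2)
    \<le> (network_dist n S S')\<^sup>2"
  unfolding network_dist_sq[OF assms(1,2)] using assms(3)
  by (subst real_sqrt_pow2) (auto intro!: sum_nonneg add_nonneg_nonneg
      member_le_sum[of i _ "\<lambda>i. (frob_norm (fst (S i) - fst (S' i)))\<^sup>2 + (\<Sum>k<2 * N. (snd (S i) $ k - snd (S' i) $ k)\<^sup>2)"])

lemma network_dist_nonneg: "S \<in> V \<Longrightarrow> S' \<in> V \<Longrightarrow> network_dist n S S' \<ge> 0"
  by (auto simp: network_dist_sq intro!: sum_nonneg add_nonneg_nonneg)

lemma est_le_network_dist:
  assumes "S \<in> V" "S' \<in> V" "i < n" "a < rd i" "b < cd i"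
  shows "\<bar>fst (S i) $$ (a, b) - fst (S' i) $$ (a, b)\<bar> \<le> network_dist n S S'"
proof -
  have "\<bar>fst (S i) $$ (a, b) - fst (S' i) $$ (a, b)\<bar> \<le> frob_norm (fst (S i) - fst (S' i))"
    using entry_le_frob_norm[of a "fst (S i) - fst (S' i)" b] assms by (simp add: V_D)
  also have "(frob_norm (fst (S i) - fst (S' i)))\<^sup>2 \<le> (network_dist n S S')\<^sup>2"
    using node_le_network_dist[OF assms(1-3)] sum_nonneg[of "{..<2 * N}" "\<lambda>k. (snd (S i) $ k - snd (S' i) $ k)\<^sup>2"]
    by simp
  then have "frob_norm (fst (S i) - fst (S' i)) \<le> network_dist n S S'"
    by (rule power2_le_imp_le) (rule network_dist_nonneg[OF assms(1,2)])
  finally show ?thesis .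
qed

lemma var_le_network_dist:
  assumes "S \<in> V" "S' \<in> V" "i < n" "k < N"
  shows "\<bar>var S (i, k) - var S' (i, k)\<bar> \<le> network_dist n S S'"
proof -
  have "(var S (i, k) - var S' (i, k))\<^sup>2 \<le> (\<Sum>k<2 * N. (snd (S i) $ k - snd (S' i) $ k)\<^sup>2)"
    unfolding var_def case_prod_conv using assms(4)
    by (intro member_le_sum[of k _ "\<lambda>k. (snd (S i) $ k - snd (S' i) $ k)\<^sup>2"]) auto
  also have "\<dots> \<le> (network_dist n S S')\<^sup>2"
    using node_le_network_dist[OF assms(1-3)] zero_le_power2[of "frob_norm (fst (S i) - fst (S' i))"]
    by linarith
  finally have "\<bar>var S (i, k) - var S' (i, k)\<bar> \<le> \<bar>network_dist n S S'\<bar>"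
    by (simp only: abs_le_square_iff)
  then show ?thesis using network_dist_nonneg[OF assms(1,2)] by simp
qed

lemma network_dist_le:
  assumes "S \<in> V" "S' \<in> V" "0 \<le> d"
    and est: "\<And>i a b. i < n \<Longrightarrow> a < rd i \<Longrightarrow> b < cd i \<Longrightarrow> \<bar>fst (S i) $$ (a, b) - fst (S' i) $$ (a, b)\<bar> \<le> d"
    and aux: "\<And>i k. i < n \<Longrightarrow> k < 2 * N \<Longrightarrow> \<bar>snd (S i) $ k - snd (S' i) $ k\<bar> \<le> d"
  shows "network_dist n S S' \<le> sqrt (\<Sum>i<n. real (rd i * cd i) + 2 * N) * d"
proof -
  have "(frob_norm (fst (S i) - fst (S' i)))\<^sup>2 + (\<Sum>k<2 * N. (snd (S i) $ k - snd (S' i) $ k)\<^sup>2)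
      \<le> (real (rd i * cd i) + 2 * N) * d\<^sup>2" if i: "i < n" for i
  proof -
    have "frob_norm (fst (S i) - fst (S' i)) \<le> sqrt (real (rd i * cd i)) * d"
      using frob_norm_le[of "fst (S i) - fst (S' i)" d] assms i by (simp add: V_D)
    then have "(frob_norm (fst (S i) - fst (S' i)))\<^sup>2 \<le> (sqrt (real (rd i * cd i)) * d)\<^sup>2"
      by (intro power_mono) (auto simp: frob_norm_def sum_nonneg)
    moreover have "(\<Sum>k<2 * N. (snd (S i) $ k - snd (S' i) $ k)\<^sup>2) \<le> (\<Sum>k<2 * N. d\<^sup>2)"
      using aux[OF i] assms(3) by (intro sum_mono) (auto simp: abs_le_square_iff[symmetric])
    ultimately show ?thesis by (simp add: power_mult_distrib distrib_right)
  qed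
  then have "network_dist n S S' \<le> sqrt (\<Sum>i<n. (real (rd i * cd i) + 2 * N) * d\<^sup>2)"
    unfolding network_dist_sq[OF assms(1,2)] by (intro real_sqrt_le_mono sum_mono) auto
  then show ?thesis
    using assms(3) by (simp add: sum_distrib_right[symmetric] real_sqrt_mult)
qed

lemma lipschitz: "lipschitz_ode n V P"
proof -
  obtain \<kappa> where \<kappa>: "\<kappa> \<ge> 0"
    "\<And>x d j. 0 \<le> d \<Longrightarrow> (\<forall>i\<in>I. \<bar>x i\<bar> \<le> d) \<Longrightarrow> j \<in> I \<Longrightarrow> \<bar>lin I K x j\<bar> \<le> \<kappa> * d"
    using lin_bounded[OF finite_I finite_I, of K] by blast
  obtain \<kappa>' where \<kappa>': "\<kappa>' \<ge> 0"
    "\<And>x d j. 0 \<le> d \<Longrightarrow> (\<forall>i\<in>I. \<bar>x i\<bar> \<le> d) \<Longrightarrow> j \<in> I \<Longrightarrow> \<bar>lin I (tr K) x j\<bar> \<le> \<kappa>' * d"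
    using lin_bounded[OF finite_I finite_I, of "tr K"] by blast
  \<comment> \<open>States at distance \<open>d\<close> change residuals by at most
    \<open>\<kappa> * d\<close>, gradients by \<open>\<kappa>' * \<kappa> * d\<close>, and estimate
    derivatives by a further \<open>2 * d\<close> from the variable and the estimate;
    \<open>q\<close> dominates all three.\<close>
  define q where "q = \<kappa> + \<kappa>' * \<kappa> + 2"
  have q: "q \<ge> 0" "\<kappa> \<le> q" "\<kappa>' * \<kappa> \<le> q" "\<kappa>' * \<kappa> + 2 \<le> q"
    using \<kappa>(1) \<kappa>'(1) by (auto simp: q_def)
  have "network_dist n (field S) (field S') \<le>
      (sqrt (\<Sum>i<n. real (rd i * cd i) + 2 * N) * q) * network_dist n S S'"
    if S: "S \<in> V" "S' \<in> V" for S S'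
  proof -
    define d where "d = network_dist n S S'"
    have d: "d \<ge> 0" using S by (simp add: d_def network_dist_nonneg)
    have var: "\<bar>var S j - var S' j\<bar> \<le> d" if "j \<in> I" for j
      using that var_le_network_dist[OF S] by (auto simp: I_def d_def)
    have res: "\<bar>res S j - res S' j\<bar> \<le> \<kappa> * d" if "j \<in> I" for j
      using \<kappa>(2)[OF d, of "\<lambda>j. var S j - var S' j" j] var that by (simp add: res_def lin_diff)
    have grad: "\<bar>grad S j - grad S' j\<bar> \<le> \<kappa>' * \<kappa> * d" if "j \<in> I" for j
      using \<kappa>'(2)[of "\<kappa> * d" "\<lambda>j. res S j - res S' j" j] res that d \<kappa>(1)
      by (simp add: grad_def lin_diff mult.assoc)
    have le: "\<kappa> * d \<le> q * d" "\<kappa>' * \<kappa> * d \<le> q * d" "\<kappa>' * \<kappa> * d + 2 * d \<le> q * d"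
      using q d mult_right_mono[of _ q d] by (auto simp: distrib_right[symmetric])
    have "network_dist n (field S) (field S') \<le> sqrt (\<Sum>i<n. real (rd i * cd i) + 2 * N) * (q * d)"
    proof (rule network_dist_le[OF field_V field_V])
      show "0 \<le> q * d" using q d by simp
    next
      fix i a b assume i: "i < n" "a < rd i" "b < cd i"
      then have "(i, pos i (a, b)) \<in> I" using pos by (simp add: I_def)
      then show "\<bar>fst (field S i) $$ (a, b) - fst (field S' i) $$ (a, b)\<bar> \<le> q * d"
        using grad[of "(i, pos i (a, b))"] var[of "(i, pos i (a, b))"] le(3)
          est_le_network_dist[OF S i] i
        by (simp add: fst_field d_def[symmetric])
    next
      fix i k assume i: "i < n" "k < 2 * N"
      then show "\<bar>snd (field S i) $ k - snd (field S' i) $ k\<bar> \<le> q * d"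
        using grad[of "(i, k)"] res[of "(i, k - N)"] le(1,2)
        by (cases "k < N") (auto simp: snd_field I_def less_diff_conv2)
    qed
    then show ?thesis by (simp add: d_def mult.assoc)
  qed
  then show ?thesis
    unfolding lipschitz_ode_def using field_V P_iff by blast
qed

section \<open>Existence and convergence of trajectories\<close>

lemma trajectory_exists:
  assumes "S\<^sub>0 \<in> V"
  shows "\<exists>s. trajectory n V P S\<^sub>0 s"
proof -
  \<comment> \<open>The integrated residual \<open>\<theta>\<close> determines everything else: \<open>v = v 0 - K\<^sup>T \<theta>\<close>, so \<open>\<theta>\<close> obeys
    the affine equation \<open>\<theta>' = K v 0 - b - K K\<^sup>T \<theta>\<close>.\<close>
  define M where "M = (\<lambda>j j'. - lin I K (\<lambda>i. K j' i) j)"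
  have M: "lin I M \<theta> j = - lin I K (lin I (tr K) \<theta>) j" for \<theta> j
    unfolding lin_def M_def tr_def sum_distrib_left sum_distrib_right sum_negf[symmetric]
    by (subst sum.swap) (simp add: mult_ac)
  obtain \<theta> where \<theta>0: "\<And>j. j \<in> I \<Longrightarrow> \<theta> 0 j = 0" and \<theta>:
    "\<And>t j. j \<in> I \<Longrightarrow> ((\<lambda>u. \<theta> u j) has_real_derivative lin I M (\<theta> t) j + res S\<^sub>0 j) (at t)"
    using affine_ode_solvable[OF finite_I, of "\<lambda>_. 0" M "res S\<^sub>0"] by blast
  define v where "v t j = var S\<^sub>0 j - lin I (tr K) (\<theta> t) j" for t j
  \<comment> \<open>The estimate is its tracked variable plus the initial tracking error damped by
    \<open>exp (- t)\<close>.\<close>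
  define s where "s t = restrict (\<lambda>i.
      (mat (rd i) (cd i) (\<lambda>ab. v t (i, pos i ab) + exp (- t) * (fst (S\<^sub>0 i) $$ ab - var S\<^sub>0 (i, pos i ab))),
       vec (2 * N) (\<lambda>k. if k < N then v t (i, k) else snd (S\<^sub>0 i) $ k + \<theta> t (i, k - N)))) {..<n}" for t
  have sV: "s t \<in> V" for t
    by (rule V_I) (auto simp: s_def)
  have var_s: "var (s t) j = v t j" if "j \<in> I" for t j
    using that by (auto simp: var_def s_def I_def)
  have res_s: "res (s t) j = lin I M (\<theta> t) j + res S\<^sub>0 j" for t j
  proof -
    have "lin I K (var (s t)) j = lin I K (v t) j"
      by (rule lin_cong) (rule var_s)
    then show ?thesis by (simp add: res_def v_def[abs_def] lin_diff M)
  qed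
  have \<theta>': "((\<lambda>u. \<theta> u j) has_real_derivative res (s t) j) (at t within {0..})" if "j \<in> I" for t j
    using \<theta>[OF that, of t] by (simp add: res_s has_field_derivative_at_within)
  have v': "((\<lambda>u. v u j) has_real_derivative - grad (s t) j) (at t within {0..})" for t j
    unfolding v_def grad_def by (auto intro!: derivative_eq_intros has_derivative_lin \<theta>')
  have "s 0 = S\<^sub>0"
  proof (rule V_eqI[OF sV assms])
    have v0: "v 0 j = var S\<^sub>0 j" for j
      using \<theta>0 by (simp add: v_def lin_def)
    show "fst (s 0 i) $$ (a, b) = fst (S\<^sub>0 i) $$ (a, b)" if "i < n" "a < rd i" "b < cd i" for i a b
      using that by (simp add: s_def v0)
    show "var (s 0) (i, k) = var S\<^sub>0 (i, k)" if "i < n" "k < N" for i k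
      using that by (simp add: var_s v0 I_def)
    show "acc (s 0) (i, k) = acc S\<^sub>0 (i, k)" if "i < n" "k < N" for i k
      using that by (simp add: s_def acc_def \<theta>0 I_def)
  qed
  moreover have "has_network_derivative n s (field (s t)) t" for t
    unfolding has_network_derivative_def
  proof (intro allI impI conjI)
    fix i a b assume i: "i < n" and "a < dim_row (fst (field (s t) i))" "b < dim_col (fst (field (s t) i))"
    then have ab: "a < rd i" "b < cd i" using field_V V_D by auto
    have "((\<lambda>u. v u (i, pos i (a, b)) + exp (- u) * (fst (S\<^sub>0 i) $$ (a, b) - var S\<^sub>0 (i, pos i (a, b))))
        has_real_derivative fst (field (s t) i) $$ (a, b)) (at t within {0..})"
      by (rule derivative_eq_intros v' refl)+
         (use i ab pos var_s[of "(i, pos i (a, b))" t] in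
           \<open>simp add: fst_field I_def, simp add: s_def\<close>)
    then show "((\<lambda>u. fst (s u i) $$ (a, b)) has_real_derivative fst (field (s t) i) $$ (a, b)) (at t within {0..})"
      using i ab by (simp add: s_def)
  next
    fix i k assume i: "i < n" and "k < dim_vec (snd (field (s t) i))"
    then have k: "k < 2 * N" using field_V V_D by auto
    have "((\<lambda>u. if k < N then v u (i, k) else snd (S\<^sub>0 i) $ k + \<theta> u (i, k - N))
        has_real_derivative (if k < N then - grad (s t) (i, k) else res (s t) (i, k - N))) (at t within {0..})"
      using i k by (auto intro!: derivative_eq_intros v' \<theta>' simp: I_def)
    then show "((\<lambda>u. snd (s u i) $ k) has_real_derivative snd (field (s t) i) $ k) (at t within {0..})"
      using i k by (simp only: snd_field) (simp add: s_def)
  qed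
  ultimately show ?thesis
    unfolding trajectory_def using sV field_V P_iff by blast
qed

text \<open>By \<open>P_iff\<close> every trajectory follows \<open>field\<close>, so its variables
  perform the gradient flow, and the estimates approach the variables they track.\<close>

lemma trajectory_converges:
  assumes consistent: "\<exists>w. \<forall>j\<in>I. lin I K w j = rhs j"
    and s: "trajectory n V P S\<^sub>0 s"
  shows "\<exists>l. (\<forall>j\<in>I. lin I K l j = rhs j) \<and>
    (\<forall>i<n. converges_exponentially (\<lambda>t. fst (s t i)) (mat (rd i) (cd i) (\<lambda>ab. l (i, pos i ab))))"
proof -
  have sV: "s t \<in> V" and deriv: "has_network_derivative n s (field (s t)) t" if "t \<ge> 0" for t
    using s that P_iff unfolding trajectory_def by auto
  have v': "((\<lambda>u. var (s u) (i, k)) has_real_derivative - grad (s t) (i, k)) (at t within {0..})"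
    if "t \<ge> 0" "i < n" "k < N" for t i k
  proof -
    have "k < dim_vec (snd (field (s t) i))"
      using that V_D(3)[OF field_V] by simp
    then have "((\<lambda>u. snd (s u i) $ k) has_real_derivative snd (field (s t) i) $ k) (at t within {0..})"
      using deriv[OF that(1)] that(2) unfolding has_network_derivative_def by blast
    then show ?thesis
      using var_field[OF that(2,3), of "s t"] by (simp only: var_def case_prod_conv)
  qed
  have x': "((\<lambda>u. fst (s u i) $$ (a, b)) has_real_derivative
      - grad (s t) (i, pos i (a, b)) + var (s t) (i, pos i (a, b)) - fst (s t i) $$ (a, b)) (at t within {0..})"
    if "t \<ge> 0" "i < n" "a < rd i" "b < cd i" for t i a b
  proof -
    have "a < dim_row (fst (field (s t) i))" "b < dim_col (fst (field (s t) i))"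
      using that V_D(1,2)[OF field_V] by simp_all
    then have "((\<lambda>u. fst (s u i) $$ (a, b)) has_real_derivative fst (field (s t) i) $$ (a, b)) (at t within {0..})"
      using deriv[OF that(1)] that(2) unfolding has_network_derivative_def by blast
    then show ?thesis by (simp only: fst_field[OF that(2-4)])
  qed
  obtain l r \<mu> where \<mu>: "0 < \<mu>" and l: "\<forall>j\<in>I. lin I K l j = rhs j"
    and conv: "\<And>j t. j \<in> I \<Longrightarrow> t \<ge> 0 \<Longrightarrow> \<bar>var (s t) j - l j\<bar> \<le> r * exp (- \<mu> * t)"
  proof -
    obtain w where w: "\<forall>j\<in>I. lin I K w j = rhs j" using consistent by blast
    have "((\<lambda>u. var (s u) j) has_real_derivative
        - lin I (tr K) (\<lambda>j. lin I K (var (s t)) j - rhs j) j) (at t within {0..})"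
      if "t \<ge> 0" "j \<in> I" for t j
      using v'[OF that(1)] that(2) by (auto simp: I_def grad_def res_def[abs_def])
    from gradient_flow_converges[OF finite_I finite_I w this]
    show ?thesis using that by blast
  qed
  \<comment> \<open>The slower of two rates: that of the variables and rate 1 of the tracking
    error.\<close>
  define \<nu> where "\<nu> = min \<mu> 1"
  have \<nu>: "0 < \<nu>" "\<nu> \<le> \<mu>" "\<nu> \<le> 1" using \<mu> by (auto simp: \<nu>_def)
  have "converges_exponentially (\<lambda>t. fst (s t i)) (mat (rd i) (cd i) (\<lambda>ab. l (i, pos i ab)))"
    if i: "i < n" for i
  proof -
    define \<delta> where "\<delta> t a b = fst (s t i) $$ (a, b) - var (s t) (i, pos i (a, b))" for t a b
    have \<delta>: "\<bar>\<delta> t a b\<bar> \<le> \<bar>\<delta> 0 a b\<bar> * exp (- t)" if ab: "a < rd i" "b < cd i" and t: "t \<ge> 0" for t a b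
    proof -
      have "((\<lambda>t. (\<delta> t a b)\<^sup>2) has_real_derivative - 2 * (\<delta> t a b)\<^sup>2) (at t within {0..})" if "t \<ge> 0" for t
        unfolding \<delta>_def
        by (rule derivative_eq_intros x' v' refl that i ab pos)+
           (simp add: power2_eq_square algebra_simps)
      then have "(\<delta> t a b)\<^sup>2 \<le> (\<delta> 0 a b)\<^sup>2 * exp (- 2 * t)"
        by (rule exponential_decay) (use t in auto)
      also have "\<dots> = (\<delta> 0 a b * exp (- t))\<^sup>2"
        using exp_double[of "- t"] by (simp add: power_mult_distrib)
      finally have "\<bar>\<delta> t a b\<bar> \<le> \<bar>\<delta> 0 a b * exp (- t)\<bar>"
        by (simp only: abs_le_square_iff)
      then show ?thesis by (simp add: abs_mult)
    qed
    define q where "q = (\<Sum>a<rd i. \<Sum>b<cd i. \<bar>\<delta> 0 a b\<bar>) + \<bar>r\<bar>"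
    have q0: "q \<ge> 0" by (auto simp: q_def intro!: add_nonneg_nonneg sum_nonneg)
    have entry: "\<bar>fst (s t i) $$ (a, b) - l (i, pos i (a, b))\<bar> \<le> q * exp (- \<nu> * t)"
      if ab: "a < rd i" "b < cd i" and t: "t \<ge> 0" for t a b
    proof -
      have "\<bar>\<delta> 0 a b\<bar> \<le> (\<Sum>b<cd i. \<bar>\<delta> 0 a b\<bar>)"
        using ab by (intro member_le_sum) auto
      also have "\<dots> \<le> (\<Sum>a<rd i. \<Sum>b<cd i. \<bar>\<delta> 0 a b\<bar>)"
        using ab by (intro member_le_sum[of a _ "\<lambda>a. \<Sum>b<cd i. \<bar>\<delta> 0 a b\<bar>"]) (auto intro: sum_nonneg)
      finally have "\<bar>\<delta> 0 a b\<bar> * exp (- t) \<le> (\<Sum>a<rd i. \<Sum>b<cd i. \<bar>\<delta> 0 a b\<bar>) * exp (- \<nu> * t)"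
        using \<nu>(1,3) t by (intro mult_mono) (auto intro!: sum_nonneg mult_left_le_one_le)
      moreover have "r * exp (- \<mu> * t) \<le> \<bar>r\<bar> * exp (- \<nu> * t)"
        using \<nu>(2) t by (intro mult_mono) (auto intro!: mult_right_mono)
      moreover have "\<bar>var (s t) (i, pos i (a, b)) - l (i, pos i (a, b))\<bar> \<le> r * exp (- \<mu> * t)"
        using conv[of "(i, pos i (a, b))" t] pos i ab t by (simp add: I_def)
      ultimately show ?thesis
        using \<delta>[OF ab t] unfolding \<delta>_def[of t] q_def distrib_right by linarith
    qed
    have "frob_norm (fst (s t i) - mat (rd i) (cd i) (\<lambda>ab. l (i, pos i ab)))
        \<le> (sqrt (real (rd i * cd i)) * q) * exp (- \<nu> * t)" if t: "t \<ge> 0" for t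
      using frob_norm_le[of "fst (s t i) - mat (rd i) (cd i) (\<lambda>ab. l (i, pos i ab))" "q * exp (- \<nu> * t)"]
        entry[OF _ _ t] q0 V_D(1,2)[OF sV[OF t] i]
      by (simp add: mult.assoc)
    then show ?thesis
      unfolding converges_exponentially_def using \<nu>(1) q0
      by (intro exI[of _ "sqrt (real (rd i * cd i)) * q"] conjI exI[of _ \<nu>]) auto
  qed
  then show ?thesis using l by blast
qed

end

section \<open>Sums of local systems\<close>

text \<open>The \<open>2 N0\<close> variables of an agent are its copy of the unknowns and its multipliers. As the
  equations below \<open>N0\<close> contain nothing but the Laplacian, they express consensus; equation \<open>N0 + e\<close>
  is the agent's share of global equation \<open>e\<close>, balanced by the Laplacian of the multipliers.\<close>

lemma (in linear_network) stacked_consistent: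
  assumes N: "N = 2 * N0"
    and T: "\<And>i e k. i < n \<Longrightarrow> T i (dat i) e k = (if N0 \<le> e \<and> k < N0 then H i (e - N0) k else 0)"
    and c: "\<And>i e. i < n \<Longrightarrow> c i (dat i) e = (if N0 \<le> e then h i (e - N0) else 0)"
    and y: "\<And>e. e < N0 \<Longrightarrow> (\<Sum>i<n. (\<Sum>k<N0. H i e k * y k) - h i e) = 0"
  shows "\<exists>w. \<forall>j\<in>I. lin I K w j = rhs j"
proof -
  have "\<exists>x. \<forall>i<n. lap x i = h i e - (\<Sum>k<N0. H i e k * y k)" if "e < N0" for e
    using y[OF that] by (intro lap_solvable) (simp add: sum_subtractf)
  then obtain x where x: "\<And>e i. e < N0 \<Longrightarrow> i < n \<Longrightarrow> lap (x e) i = h i e - (\<Sum>k<N0. H i e k * y k)"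
    by metis
  \<comment> \<open>All copies equal \<open>y\<close>. The multiplier for equation
    \<open>N0 + e\<close> sits at index \<open>N0 + e\<close>, where \<open>lap\<close> acts on it
    and \<open>T\<close> has zero coefficients.\<close>
  define w where "w = (\<lambda>(i :: nat, k). if k < N0 then y k else x (k - N0) i)"
  have "lin I K w (i, e) = rhs (i, e)" if i: "i < n" and e: "e < N" for i e
  proof (cases "e < N0")
    case True
    then show ?thesis
      using i e by (simp add: lin_K T c rhs_def w_def lap_def)
  next
    case False
    have "(\<Sum>k<N. T i (dat i) e k * w (i, k)) = (\<Sum>k<N0. H i (e - N0) k * y k)"
      using i False N by (intro sum.mono_neutral_cong_right) (auto simp: T w_def)
    moreover have "lap (\<lambda>j. w (j, e)) i = lap (x (e - N0)) i"
      using False by (simp add: w_def)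
    ultimately show ?thesis
      unfolding lin_K[OF i e] using i e N False by (simp add: x rhs_def c)
  qed
  then show ?thesis by (intro exI[of _ w]) (auto simp: I_def)
qed

text \<open>The pure Laplacian equations force consensus; adding the others over all agents removes
  the multipliers because a Laplacian sums to zero.\<close>

lemma (in linear_network) stacked_solution:
  assumes N: "N = 2 * N0"
    and T: "\<And>i e k. i < n \<Longrightarrow> T i (dat i) e k = (if N0 \<le> e \<and> k < N0 then H i (e - N0) k else 0)"
    and c: "\<And>i e. i < n \<Longrightarrow> c i (dat i) e = (if N0 \<le> e then h i (e - N0) else 0)"
    and l: "\<forall>j\<in>I. lin I K l j = rhs j"
  shows "i < n \<Longrightarrow> i' < n \<Longrightarrow> k < N0 \<Longrightarrow> l (i, k) = l (i', k)"
    and "e < N0 \<Longrightarrow> (\<Sum>i<n. (\<Sum>k<N0. H i e k * l (i, k)) - h i e) = 0"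
proof -
  have eq: "(\<Sum>k<N. T i (dat i) e k * l (i, k)) + lap (\<lambda>j. l (j, e)) i = c i (dat i) e"
    if "i < n" "e < N" for i e
    using l that lin_K[OF that, of l] by (auto simp: I_def rhs_def)
  show "l (i, k) = l (i', k)" if "i < n" "i' < n" "k < N0"
  proof (rule lap_eq_0_imp_constant[of "\<lambda>j. l (j, k)", OF _ that(1,2)])
    fix i assume i: "i < n"
    show "lap (\<lambda>j. l (j, k)) i = 0"
      using eq[OF i, of k] that(3) N by (simp add: T[OF i] c[OF i])
  qed
  show "(\<Sum>i<n. (\<Sum>k<N0. H i e k * l (i, k)) - h i e) = 0" if e: "e < N0"
  proof -
    have "(\<Sum>k<N0. H i e k * l (i, k)) - h i e = - lap (\<lambda>j. l (j, N0 + e)) i" if i: "i < n" for i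
    proof -
      have "(\<Sum>k<N. T i (dat i) (N0 + e) k * l (i, k)) = (\<Sum>k<N0. H i e k * l (i, k))"
        using i N by (intro sum.mono_neutral_cong_right) (auto simp: T)
      then show ?thesis using eq[OF i, of "N0 + e"] e N by (simp add: c[OF i])
    qed
    then show ?thesis by (simp add: sum_negf sum_lap)
  qed
qed

section \<open>Splitting the normal equations\<close>

text \<open>Indexed by pairs, the map from \<open>X\<close> to \<open>A X B\<close> has the
  Kronecker-type matrix \<open>A $$ (i, a) * B $$ (b, j)\<close>, which reduces the claim to
  \<open>normal_equations_minimize\<close>.\<close>

lemma least_squares_if_normal_equations:
  assumes A: "A \<in> carrier_mat m r" and B: "B \<in> carrier_mat p q" and F: "F \<in> carrier_mat m q"
    and X: "X \<in> carrier_mat r p"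
    and normal: "\<forall>ab\<in>{..<r} \<times> {..<p}. lin ({..<m} \<times> {..<q}) (tr (\<lambda>(i, j) (a, b). A $$ (i, a) * B $$ (b, j)))
      (\<lambda>ij. lin ({..<r} \<times> {..<p}) (\<lambda>(i, j) (a, b). A $$ (i, a) * B $$ (b, j)) (($$) X) ij - F $$ ij) ab = 0"
  shows "least_squares_solution A B F X"
proof -
  define L where "L = (\<lambda>(i, j) (a, b). A $$ (i, a) * B $$ (b, j))"
  have norm: "(frob_norm (A * Y * B - F))\<^sup>2 =
      (\<Sum>ij\<in>{..<m} \<times> {..<q}. (lin ({..<r} \<times> {..<p}) L (($$) Y) ij - F $$ ij)\<^sup>2)"
    if Y: "Y \<in> carrier_mat r p" for Y
  proof -
    have "(A * Y * B) $$ (i, j) = lin ({..<r} \<times> {..<p}) L (($$) Y) (i, j)" if "i < m" "j < q" for i j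
    proof -
      have "(A * Y * B) $$ (i, j) = (\<Sum>a<r. A $$ (i, a) * (\<Sum>b<p. Y $$ (a, b) * B $$ (b, j)))"
        using that A B Y by (simp add: scalar_prod_def atLeast0LessThan)
      also have "\<dots> = (\<Sum>a<r. \<Sum>b<p. A $$ (i, a) * B $$ (b, j) * Y $$ (a, b))"
        by (simp add: sum_distrib_left mult_ac)
      finally show ?thesis
        by (simp add: lin_def L_def sum.cartesian_product case_prod_unfold)
    qed
    then show ?thesis
      using A B F Y unfolding frob_norm_sq sum.cartesian_product
      by (intro sum.cong) auto
  qed
  then show ?thesis
    using A B F X normal_equations_minimize[OF normal]
    unfolding least_squares_solution_def L_def by auto
qed

section \<open>A system affine in the data\<close>

text \<open>The intermediate unknowns keep products such as \<open>A\<^sup>T A\<close> out of the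
  coefficients, since these would mix blocks of different agents.\<close>

datatype unknown = VX nat nat | VY nat nat | VE nat nat | VU nat nat

definition unknowns :: "nat \<Rightarrow> nat \<Rightarrow> nat \<Rightarrow> nat \<Rightarrow> unknown set" where
  "unknowns m r p q =
     case_prod VX ` ({..<r} \<times> {..<p}) \<union> (case_prod VY ` ({..<r} \<times> {..<q}) \<union>
     (case_prod VE ` ({..<m} \<times> {..<q}) \<union> case_prod VU ` ({..<r} \<times> {..<q})))"

lemma finite_unknowns: "finite (unknowns m r p q)"
  by (simp add: unknowns_def)

lemma sum_unknowns:
  "(\<Sum>\<kappa>\<in>unknowns m r p q. f \<kappa>) =
     (\<Sum>a<r. \<Sum>b<p. f (VX a b)) + (\<Sum>a<r. \<Sum>b<q. f (VY a b)) +
     (\<Sum>a<m. \<Sum>b<q. f (VE a b)) + (\<Sum>a<r. \<Sum>b<q. f (VU a b) :: real)"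
proof -
  have inj: "inj_on (case_prod VX) S" "inj_on (case_prod VY) S"
    "inj_on (case_prod VE) S" "inj_on (case_prod VU) S" for S
    by (auto simp: inj_on_def)
  show ?thesis
    unfolding unknowns_def
    by (subst sum.union_disjoint; (auto; fail)?)+
       (unfold sum.reindex[OF inj(1)] sum.reindex[OF inj(2)] sum.reindex[OF inj(3)]
          sum.reindex[OF inj(4)] sum.cartesian_product, simp add: case_prod_unfold)
qed

text \<open>The equation defining \<open>Y\<close>, \<open>E\<close> or \<open>U\<close> is labelled by the unknown it defines, and \<open>U B\<^sup>T = 0\<close>
  by \<open>X\<close>, which has the same shape. The weight \<open>w\<close> is an agent's share of the data-independent
  terms: \<open>1 / n\<close> for a single agent, \<open>1\<close> for the whole system.\<close>

fun coef :: "real \<Rightarrow> (nat \<Rightarrow> nat \<Rightarrow> real) \<Rightarrow> (nat \<Rightarrow> nat \<Rightarrow> real) \<Rightarrow> unknown \<Rightarrow> unknown \<Rightarrow> real" where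
  "coef w A B (VY a b) (VX a' k) = (if a = a' then B k b else 0)"
| "coef w A B (VY a b) (VY a' b') = (if a = a' then if b = b' then - w else 0 else 0)"
| "coef w A B (VE a b) (VY k b') = (if b = b' then A a k else 0)"
| "coef w A B (VE a b) (VE a' b') = (if a = a' then if b = b' then - w else 0 else 0)"
| "coef w A B (VU a b) (VE k b') = (if b = b' then A k a else 0)"
| "coef w A B (VU a b) (VU a' b') = (if a = a' then if b = b' then - w else 0 else 0)"
| "coef w A B (VX a b) (VU a' k) = (if a = a' then B b k else 0)"
| "coef w A B _ _ = 0"

fun offset :: "(nat \<Rightarrow> nat \<Rightarrow> real) \<Rightarrow> unknown \<Rightarrow> real" where
  "offset F (VE a b) = F a b"
| "offset F _ = 0"

text \<open>Joint linearity in weight, \<open>A\<close> and \<open>B\<close> is what allows the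
  system to be distributed over any partition of the data.\<close>

lemma sum_coef:
  "(\<Sum>i\<in>S. coef (w i) (A i) (B i) \<epsilon> \<kappa>) =
     coef (\<Sum>i\<in>S. w i) (\<lambda>a b. \<Sum>i\<in>S. A i a b) (\<lambda>a b. \<Sum>i\<in>S. B i a b) \<epsilon> \<kappa>"
  by (cases \<epsilon>; cases \<kappa>) (auto simp: sum_negf)

lemma sum_offset: "(\<Sum>i\<in>S. offset (F i) \<epsilon>) = offset (\<lambda>a b. \<Sum>i\<in>S. F i a b) \<epsilon>"
  by (cases \<epsilon>) auto

lemma coef_equations:
  fixes y :: "unknown \<Rightarrow> real"
  shows "a < r \<Longrightarrow> b < q \<Longrightarrow> (\<Sum>\<kappa>\<in>unknowns m r p q. coef 1 A B (VY a b) \<kappa> * y \<kappa>) =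
      (\<Sum>k<p. y (VX a k) * B k b) - y (VY a b)"
    and "a < m \<Longrightarrow> b < q \<Longrightarrow> (\<Sum>\<kappa>\<in>unknowns m r p q. coef 1 A B (VE a b) \<kappa> * y \<kappa>) =
      (\<Sum>k<r. A a k * y (VY k b)) - y (VE a b)"
    and "a < r \<Longrightarrow> b < q \<Longrightarrow> (\<Sum>\<kappa>\<in>unknowns m r p q. coef 1 A B (VU a b) \<kappa> * y \<kappa>) =
      (\<Sum>k<m. A k a * y (VE k b)) - y (VU a b)"
    and "a < r \<Longrightarrow> b < p \<Longrightarrow> (\<Sum>\<kappa>\<in>unknowns m r p q. coef 1 A B (VX a b) \<kappa> * y \<kappa>) =
      (\<Sum>k<q. y (VU a k) * B b k)"
proof -
  \<comment> \<open>The three facts collapse the Kronecker deltas of \<open>coef\<close> in both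
    indices, in the row index, and in the column index.\<close>
  have diag: "(\<Sum>a'<s. \<Sum>b'<t. (if a = a' then if b = b' then - 1 else 0 else 0) * z a' b') = - z a b"
    if "a < s" "b < t" for s t a b and z :: "nat \<Rightarrow> nat \<Rightarrow> real"
  proof -
    have "(\<Sum>a'<s. \<Sum>b'<t. (if a = a' then if b = b' then - 1 else 0 else 0) * z a' b') =
        (\<Sum>a'<s. if a = a' then \<Sum>b'<t. if b = b' then - z a' b' else 0 else 0)"
      by (intro sum.cong) (auto simp: if_distrib[of "\<lambda>c. c * _"] cong: if_cong)
    also have "\<dots> = - z a b" using that by simp
    finally show ?thesis .
  qed
  have rows: "(\<Sum>a'<s. \<Sum>k<t. (if a = a' then u k else 0) * z a' k) = (\<Sum>k<t. z a k * u k)"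
    if "a < s" for s t a u and z :: "nat \<Rightarrow> nat \<Rightarrow> real"
  proof -
    have "(\<Sum>a'<s. \<Sum>k<t. (if a = a' then u k else 0) * z a' k) =
        (\<Sum>a'<s. if a = a' then \<Sum>k<t. z a' k * u k else 0)"
      by (intro sum.cong) (auto intro!: sum.cong)
    then show ?thesis using that by simp
  qed
  have cols: "(\<Sum>k<s. \<Sum>b'<t. (if b = b' then u k else 0) * z k b') = (\<Sum>k<s. u k * z k b)"
    if "b < t" for s t b u and z :: "nat \<Rightarrow> nat \<Rightarrow> real"
    using that by (simp add: if_distrib[of "\<lambda>c. c * _"] cong: if_cong)
  show "a < r \<Longrightarrow> b < q \<Longrightarrow> (\<Sum>\<kappa>\<in>unknowns m r p q. coef 1 A B (VY a b) \<kappa> * y \<kappa>) =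
      (\<Sum>k<p. y (VX a k) * B k b) - y (VY a b)"
    unfolding sum_unknowns coef.simps diag rows by simp
  show "a < m \<Longrightarrow> b < q \<Longrightarrow> (\<Sum>\<kappa>\<in>unknowns m r p q. coef 1 A B (VE a b) \<kappa> * y \<kappa>) =
      (\<Sum>k<r. A a k * y (VY k b)) - y (VE a b)"
    unfolding sum_unknowns coef.simps diag cols by simp
  show "a < r \<Longrightarrow> b < q \<Longrightarrow> (\<Sum>\<kappa>\<in>unknowns m r p q. coef 1 A B (VU a b) \<kappa> * y \<kappa>) =
      (\<Sum>k<m. A k a * y (VE k b)) - y (VU a b)"
    unfolding sum_unknowns coef.simps diag cols by simp
  show "a < r \<Longrightarrow> b < p \<Longrightarrow> (\<Sum>\<kappa>\<in>unknowns m r p q. coef 1 A B (VX a b) \<kappa> * y \<kappa>) =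
      (\<Sum>k<q. y (VU a k) * B b k)"
    unfolding sum_unknowns coef.simps diag rows by simp
qed

definition solves_split :: "real mat \<Rightarrow> real mat \<Rightarrow> real mat \<Rightarrow> nat \<Rightarrow> nat \<Rightarrow> nat \<Rightarrow> nat \<Rightarrow> (unknown \<Rightarrow> real) \<Rightarrow> bool" where
  "solves_split A B F m r p q y \<longleftrightarrow> (\<forall>\<epsilon>\<in>unknowns m r p q.
     (\<Sum>\<kappa>\<in>unknowns m r p q. coef 1 (curry (($$) A)) (curry (($$) B)) \<epsilon> \<kappa> * y \<kappa>) =
     offset (curry (($$) F)) \<epsilon>)"

lemma solves_split_iff:
  "solves_split A B F m r p q y \<longleftrightarrow>
     (\<forall>a<r. \<forall>b<q. y (VY a b) = (\<Sum>k<p. y (VX a k) * B $$ (k, b))) \<and>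
     (\<forall>a<m. \<forall>b<q. y (VE a b) = (\<Sum>k<r. A $$ (a, k) * y (VY k b)) - F $$ (a, b)) \<and>
     (\<forall>a<r. \<forall>b<q. y (VU a b) = (\<Sum>k<m. A $$ (k, a) * y (VE k b))) \<and>
     (\<forall>a<r. \<forall>b<p. (\<Sum>k<q. y (VU a k) * B $$ (b, k)) = 0)"
proof -
  have "(\<forall>\<epsilon>\<in>unknowns m r p q. Q \<epsilon>) \<longleftrightarrow> (\<forall>a<r. \<forall>b<p. Q (VX a b)) \<and> (\<forall>a<r. \<forall>b<q. Q (VY a b)) \<and>
      (\<forall>a<m. \<forall>b<q. Q (VE a b)) \<and> (\<forall>a<r. \<forall>b<q. Q (VU a b))" for Q
    unfolding unknowns_def by auto
  note unknowns_cases = this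
  have "(\<forall>a<r. \<forall>b<q. (\<Sum>\<kappa>\<in>unknowns m r p q. coef 1 (curry (($$) A)) (curry (($$) B)) (VY a b) \<kappa> * y \<kappa>) =
      offset (curry (($$) F)) (VY a b)) \<longleftrightarrow>
      (\<forall>a<r. \<forall>b<q. y (VY a b) = (\<Sum>k<p. y (VX a k) * B $$ (k, b)))"
    by (simp add: coef_equations eq_commute[of "y (VY _ _)"])
  moreover have "(\<forall>a<m. \<forall>b<q. (\<Sum>\<kappa>\<in>unknowns m r p q. coef 1 (curry (($$) A)) (curry (($$) B)) (VE a b) \<kappa> * y \<kappa>) =
      offset (curry (($$) F)) (VE a b)) \<longleftrightarrow>
      (\<forall>a<m. \<forall>b<q. y (VE a b) = (\<Sum>k<r. A $$ (a, k) * y (VY k b)) - F $$ (a, b))"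
    by (auto simp: coef_equations diff_eq_eq eq_diff_eq add.commute)
  moreover have "(\<forall>a<r. \<forall>b<q. (\<Sum>\<kappa>\<in>unknowns m r p q. coef 1 (curry (($$) A)) (curry (($$) B)) (VU a b) \<kappa> * y \<kappa>) =
      offset (curry (($$) F)) (VU a b)) \<longleftrightarrow>
      (\<forall>a<r. \<forall>b<q. y (VU a b) = (\<Sum>k<m. A $$ (k, a) * y (VE k b)))"
    by (simp add: coef_equations eq_commute[of "y (VU _ _)"])
  moreover have "(\<forall>a<r. \<forall>b<p. (\<Sum>\<kappa>\<in>unknowns m r p q. coef 1 (curry (($$) A)) (curry (($$) B)) (VX a b) \<kappa> * y \<kappa>) =
      offset (curry (($$) F)) (VX a b)) \<longleftrightarrow>
      (\<forall>a<r. \<forall>b<p. (\<Sum>k<q. y (VU a k) * B $$ (b, k)) = 0)"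
    by (simp add: coef_equations)
  ultimately show ?thesis
    unfolding solves_split_def unknowns_cases by (simp only: conj_ac)
qed

text \<open>The sums are grouped so that the inner ones are the entries of \<open>Y\<close> and
  \<open>U\<close>.\<close>

lemma normal_lin:
  "lin ({..<r} \<times> {..<p}) (\<lambda>(i, j) (a, b). A $$ (i, a) * B $$ (b, j)) x (i, j) =
     (\<Sum>a<r. A $$ (i, a) * (\<Sum>b<p. x (a, b) * B $$ (b, j)))"
  "lin ({..<m} \<times> {..<q}) (tr (\<lambda>(i, j) (a, b). A $$ (i, a) * B $$ (b, j))) z (a, b) =
     (\<Sum>j<q. (\<Sum>i<m. A $$ (i, a) * z (i, j)) * B $$ (b, j))"
proof -
  show "lin ({..<r} \<times> {..<p}) (\<lambda>(i, j) (a, b). A $$ (i, a) * B $$ (b, j)) x (i, j) =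
     (\<Sum>a<r. A $$ (i, a) * (\<Sum>b<p. x (a, b) * B $$ (b, j)))"
    unfolding lin_def sum_distrib_left sum.cartesian_product
    by (intro sum.cong) (auto simp: mult_ac)
  have "lin ({..<m} \<times> {..<q}) (tr (\<lambda>(i, j) (a, b). A $$ (i, a) * B $$ (b, j))) z (a, b) =
     (\<Sum>i<m. \<Sum>j<q. A $$ (i, a) * B $$ (b, j) * z (i, j))"
    by (simp add: lin_def tr_def sum.cartesian_product case_prod_unfold)
  also have "\<dots> = (\<Sum>j<q. (\<Sum>i<m. A $$ (i, a) * z (i, j)) * B $$ (b, j))"
    unfolding sum_distrib_right by (subst sum.swap) (simp add: mult_ac)
  finally show "lin ({..<m} \<times> {..<q}) (tr (\<lambda>(i, j) (a, b). A $$ (i, a) * B $$ (b, j))) z (a, b) =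
     (\<Sum>j<q. (\<Sum>i<m. A $$ (i, a) * z (i, j)) * B $$ (b, j))" .
qed

text \<open>A solution of the normal equations supplies \<open>X\<close>; the other unknowns are
  computed from their defining equations.\<close>

lemma split_solvable: "\<exists>y. solves_split A B F m r p q y"
proof -
  define L where "L = (\<lambda>(i, j) (a, b). A $$ (i, a) * B $$ (b, j))"
  obtain x where x: "\<forall>ab\<in>{..<r} \<times> {..<p}. lin ({..<m} \<times> {..<q}) (tr L)
      (\<lambda>ij. lin ({..<r} \<times> {..<p}) L x ij - F $$ ij) ab = 0"
    using normal_equations_solvable[of "{..<r} \<times> {..<p}" "{..<m} \<times> {..<q}" L "($$) F"] by auto
  define Y where "Y a b = (\<Sum>k<p. x (a, k) * B $$ (k, b))" for a b
  define E where "E a b = (\<Sum>k<r. A $$ (a, k) * Y k b) - F $$ (a, b)" for a b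
  define U where "U a b = (\<Sum>k<m. A $$ (k, a) * E k b)" for a b
  define y where "y \<kappa> = (case \<kappa> of VX a b \<Rightarrow> x (a, b) | VY a b \<Rightarrow> Y a b | VE a b \<Rightarrow> E a b | VU a b \<Rightarrow> U a b)" for \<kappa>
  have "(\<Sum>k<q. U a k * B $$ (b, k)) = 0" if "a < r" "b < p" for a b
    using x[unfolded L_def, rule_format, of "(a, b)"] that
    unfolding normal_lin by (simp add: U_def E_def Y_def)
  then show ?thesis
    by (intro exI[of _ y]) (auto simp: solves_split_iff y_def Y_def E_def U_def)
qed

text \<open>Eliminating \<open>U\<close>, \<open>E\<close> and \<open>Y\<close> turns the equations
  labelled by \<open>VX\<close> back into the normal equations.\<close>

lemma split_least_squares:
  assumes A: "A \<in> carrier_mat m r" and B: "B \<in> carrier_mat p q" and F: "F \<in> carrier_mat m q"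
    and y: "solves_split A B F m r p q y"
  shows "least_squares_solution A B F (mat r p (\<lambda>(a, b). y (VX a b)))"
proof (rule least_squares_if_normal_equations[OF A B F], simp, intro ballI)
  define X where "X = mat r p (\<lambda>(a, b). y (VX a b))"
  note y' = y[unfolded solves_split_iff]
  fix ab assume "ab \<in> {..<r} \<times> {..<p}"
  then obtain a b where ab: "ab = (a, b)" "a < r" "b < p" by auto
  have E: "(\<Sum>a<r. A $$ (i, a) * (\<Sum>b<p. X $$ (a, b) * B $$ (b, j))) - F $$ (i, j) = y (VE i j)"
    if "i < m" "j < q" for i j
    using y' that by (simp add: X_def)
  have "(\<Sum>j<q. (\<Sum>i<m. A $$ (i, a) * ((\<Sum>a<r. A $$ (i, a) * (\<Sum>b<p. X $$ (a, b) * B $$ (b, j))) - F $$ (i, j))) * B $$ (b, j)) =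
      (\<Sum>j<q. (\<Sum>i<m. A $$ (i, a) * y (VE i j)) * B $$ (b, j))"
    by (intro sum.cong refl arg_cong2[of _ _ _ _ "(*)"]) (simp add: E)
  also have "\<dots> = (\<Sum>j<q. y (VU a j) * B $$ (b, j))"
    using y'[THEN conjunct2, THEN conjunct2, THEN conjunct1] ab
    by (intro sum.cong refl arg_cong2[of _ _ _ _ "(*)"]) simp
  also have "\<dots> = 0" using y'[THEN conjunct2, THEN conjunct2, THEN conjunct2] ab by simp
  finally show "lin ({..<m} \<times> {..<q}) (tr (\<lambda>(i, j) (a, b). A $$ (i, a) * B $$ (b, j)))
      (\<lambda>ij. lin ({..<r} \<times> {..<p}) (\<lambda>(i, j) (a, b). A $$ (i, a) * B $$ (b, j)) (($$) X) ij - F $$ ij) ab = 0"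
    unfolding ab(1) normal_lin .
qed

section \<open>Blocks\<close>

text \<open>Here \<open>M\<close> is the block alone while \<open>a\<close> and \<open>b\<close> are
  global indices, so an agent can evaluate this from what it knows.\<close>

fun padded :: "letter \<Rightarrow> (nat \<Rightarrow> nat) \<Rightarrow> (nat \<Rightarrow> nat) \<Rightarrow> nat \<Rightarrow> real mat \<Rightarrow> nat \<Rightarrow> nat \<Rightarrow> real" where
  "padded R rsz csz i M a b =
     (if (\<Sum>j<i. rsz j) \<le> a \<and> a < (\<Sum>j<Suc i. rsz j) then M $$ (a - (\<Sum>j<i. rsz j), b) else 0)"
| "padded C rsz csz i M a b =
     (if (\<Sum>j<i. csz j) \<le> b \<and> b < (\<Sum>j<Suc i. csz j) then M $$ (a, b - (\<Sum>j<i. csz j)) else 0)"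

text \<open>Consecutive blocks tile an initial segment of the indices, and each induction step
  appends one block.\<close>

lemma sum_block_indicator:
  "(\<Sum>i<n. if (\<Sum>j<i. sz j) \<le> a \<and> a < (\<Sum>j<Suc i. sz j) then x else 0) =
     (if a < (\<Sum>j<n. sz j) then x else (0 :: real))" for a :: nat
  by (induction n) auto

lemma sum_padded_block:
  assumes "M \<in> carrier_mat k l" "a < k" "b < l"
    and "L = R \<Longrightarrow> block_sizes n rsz k" "L = C \<Longrightarrow> block_sizes n csz l"
  shows "(\<Sum>i<n. padded L rsz csz i (block L rsz csz i M) a b) = M $$ (a, b)"
proof (cases L)
  case R
  then have "(\<Sum>i<n. padded L rsz csz i (block L rsz csz i M) a b) =
      (\<Sum>i<n. if (\<Sum>j<i. rsz j) \<le> a \<and> a < (\<Sum>j<Suc i. rsz j) then M $$ (a, b) else 0)"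
    using assms(1-3) by (intro sum.cong) (auto simp: row_block_def)
  then show ?thesis
    using assms(2,4) R unfolding sum_block_indicator by (simp add: block_sizes_def)
next
  case C
  then have "(\<Sum>i<n. padded L rsz csz i (block L rsz csz i M) a b) =
      (\<Sum>i<n. if (\<Sum>j<i. csz j) \<le> b \<and> b < (\<Sum>j<Suc i. csz j) then M $$ (a, b) else 0)"
    using assms(1-3) by (intro sum.cong) (auto simp: col_block_def)
  then show ?thesis
    using assms(3,5) C unfolding sum_block_indicator by (simp add: block_sizes_def)
qed

lemma block_end_le:
  assumes "block_sizes n sz N" "i < n"
  shows "(\<Sum>j<i. sz j) + sz i \<le> N"
proof -
  have "(\<Sum>j<Suc i. sz j) \<le> (\<Sum>j<n. sz j)"
    using assms(2) by (intro sum_mono2) auto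
  then show ?thesis using assms(1) by (simp add: block_sizes_def)
qed

section \<open>Uniform description of the estimated parts\<close>

fun part_rows :: "part \<Rightarrow> nat \<Rightarrow> (nat \<Rightarrow> nat) \<Rightarrow> nat \<Rightarrow> nat" where
  "part_rows Row_Block r rs i = rs i"
| "part_rows _ r rs i = r"

fun part_cols :: "part \<Rightarrow> nat \<Rightarrow> (nat \<Rightarrow> nat) \<Rightarrow> nat \<Rightarrow> nat" where
  "part_cols Column_Block p ps i = ps i"
| "part_cols _ p ps i = p"

fun part_index :: "part \<Rightarrow> (nat \<Rightarrow> nat) \<Rightarrow> (nat \<Rightarrow> nat) \<Rightarrow> nat \<Rightarrow> nat \<times> nat \<Rightarrow> nat \<times> nat" where
  "part_index Full rs ps i (a, b) = (a, b)"
| "part_index Column_Block rs ps i (a, b) = (a, (\<Sum>j<i. ps j) + b)"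
| "part_index Row_Block rs ps i (a, b) = ((\<Sum>j<i. rs j) + a, b)"

lemma part_carrier_eq:
  "part_carrier pt r p rs ps i = carrier_mat (part_rows pt r rs i) (part_cols pt p ps i)"
  by (cases pt) auto

lemma part_of_eq:
  "X \<in> carrier_mat r p \<Longrightarrow> part_of pt rs ps i X =
    mat (part_rows pt r rs i) (part_cols pt p ps i) (\<lambda>ab. X $$ part_index pt rs ps i ab)"
  by (cases pt) (auto simp: row_block_def col_block_def)

lemma part_index_bound:
  assumes "pt = Row_Block \<Longrightarrow> block_sizes n rs r" "pt = Column_Block \<Longrightarrow> block_sizes n ps p"
    and "i < n" "a < part_rows pt r rs i" "b < part_cols pt p ps i"
  shows "part_index pt rs ps i (a, b) \<in> {..<r} \<times> {..<p}"
  using assms block_end_le[of n rs r i] block_end_le[of n ps p i] by (cases pt) auto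

text \<open>Ties the shape of the estimate to the letter that guarantees \<open>rs\<close> or
  \<open>ps\<close> to be a genuine partition.\<close>

lemma estimated_part_letters:
  "estimated_part lA lB lF = Row_Block \<Longrightarrow> lA = C"
  "estimated_part lA lB lF = Column_Block \<Longrightarrow> lB = R"
  by (cases lA; cases lB; cases lF; simp)+

section \<open>Assembly of the algorithm for all structures\<close>

theorem mainTheorem1:
  fixes lA lB lF :: letter
    and n m r p q :: nat
    and ms rs ps qs :: "nat \<Rightarrow> nat"
  assumes "0 < m" and "0 < r" and "0 < p" and "0 < q"
    and "lA = R \<or> lF = R \<Longrightarrow> block_sizes n ms m"
    and "lA = C \<Longrightarrow> block_sizes n rs r"
    and "lB = R \<Longrightarrow> block_sizes n ps p"
    and "lB = C \<or> lF = C \<Longrightarrow> block_sizes n qs q"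
  shows "\<exists>(aux_dim :: nat \<Rightarrow> nat) (g :: algorithm).
    \<forall>(G :: nat pair_pre_digraph) (W :: real mat) (A :: real mat) (B :: real mat) (F :: real mat).
      connected_graph_on n G \<longrightarrow> weighted_adjacency n G W \<longrightarrow>
      A \<in> carrier_mat m r \<longrightarrow> B \<in> carrier_mat p q \<longrightarrow> F \<in> carrier_mat m q \<longrightarrow>
      (let V = network_states n (part_carrier (estimated_part lA lB lF) r p rs ps) aux_dim;
           P = obeys_rules n G W (known_data lA lB lF ms rs ps qs A B F) g
       in lipschitz_ode n V P \<and>
          (\<forall>S\<^sub>0\<in>V.
             (\<exists>s. trajectory n V P S\<^sub>0 s) \<and>
             (\<forall>s. trajectory n V P S\<^sub>0 s \<longrightarrow>
                (\<exists>X. least_squares_solution A B F X \<and>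
                   (\<forall>i<n. converges_exponentially (\<lambda>t. fst (s t i))
                              (part_of (estimated_part lA lB lF) rs ps i X))))))"
proof -
  \<comment> \<open>The letter for \<open>A\<close> makes \<open>m\<close> or \<open>r\<close>, both
    positive, a sum of \<open>n\<close> block sizes. This is needed for the weight
    \<open>1 / real n\<close>.\<close>
  have n: "n > 0"
    using assms by (cases lA) (auto simp: block_sizes_def intro!: Nat.gr0I)
  define pt where "pt = estimated_part lA lB lF"
  define Us where "Us = unknowns m r p q"
  define N where "N = card Us"
  \<comment> \<open>Unknowns are numbered because auxiliary vectors are indexed by natural
    numbers.\<close>
  obtain dec where dec: "bij_betw dec {..<N} Us"
    using ex_bij_betw_nat_finite[OF finite_unknowns, of m r p q]
    by (auto simp: N_def Us_def atLeast0LessThan)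
  define enc where "enc = the_inv_into {..<N} dec"
  have enc_lt: "enc \<kappa> < N" and dec_enc: "dec (enc \<kappa>) = \<kappa>" if "\<kappa> \<in> Us" for \<kappa>
    using that dec the_inv_into_into[of dec "{..<N}" \<kappa> "{..<N}"] f_the_inv_into_f_bij_betw[OF dec]
    by (auto simp: enc_def bij_betw_def)
  have enc_dec: "enc (dec k) = k" if "k < N" for k
    using that dec by (simp add: enc_def the_inv_into_f_f bij_betw_def)
  have dec_Us: "dec k \<in> Us" if "k < N" for k
    using that dec by (auto simp: bij_betw_def)
  \<comment> \<open>\<open>H\<close> and \<open>h\<close> form the share of agent \<open>i\<close>
    in the split system, computed from its own blocks.\<close>
  define H where "H = (\<lambda>i (dA, dB, dF :: real mat) e k.
    coef (1 / real n) (padded lA ms rs i dA) (padded lB ps qs i dB) (dec e) (dec k))"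
  define h where "h = (\<lambda>i (dA :: real mat, dB :: real mat, dF) e. offset (padded lF ms qs i dF) (dec e))"
  define T where "T i d e k = (if N \<le> e \<and> k < N then H i d (e - N) k else 0)" for i d e k
  define c where "c i d e = (if N \<le> e then h i d (e - N) else 0)" for i d e
  define rd where "rd = part_rows pt r rs"
  define cd where "cd = part_cols pt p ps"
  define pos where "pos i ab = enc (case_prod VX (part_index pt rs ps i ab))" for i ab
  have index: "part_index pt rs ps i (a, b) \<in> {..<r} \<times> {..<p}" if "i < n" "a < rd i" "b < cd i" for i a b
    using that assms(6,7) estimated_part_letters[of lA lB lF]
    by (intro part_index_bound[of pt n]) (auto simp: rd_def cd_def pt_def)
  have VX_Us: "case_prod VX ab \<in> Us" if "ab \<in> {..<r} \<times> {..<p}" for ab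
    using that by (auto simp: Us_def unknowns_def)
  show ?thesis
  \<comment> \<open>The witnesses are chosen before graph, weights and data. Copies and multipliers
    make \<open>2 * N\<close> variables, doubled once more by the accumulators.\<close>
  proof (intro exI[of _ "\<lambda>_. 2 * (2 * N)"] exI[of _ "agent_rule n (2 * N) rd cd pos T c"] allI impI)
    fix G :: "nat pair_pre_digraph" and W A B F :: "real mat"
    assume GW: "connected_graph_on n G" "weighted_adjacency n G W"
      and A: "A \<in> carrier_mat m r" and B: "B \<in> carrier_mat p q" and F: "F \<in> carrier_mat m q"
    define dat where "dat = known_data lA lB lF ms rs ps qs A B F"
    interpret net: linear_network n G W "2 * N" rd cd pos T c dat
    proof unfold_locales
      show "pos i (a, b) < 2 * N" if "i < n" "a < rd i" "b < cd i" for i a b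
        using enc_lt[OF VX_Us[OF index[OF that]]] by (simp add: pos_def)
    qed (use GW in auto)
    \<comment> \<open>Summed over the agents, padded blocks restore \<open>A\<close>,
      \<open>B\<close> and \<open>F\<close>, and the weights add up to 1.\<close>
    have split: "(\<Sum>i<n. (\<Sum>k<N. H i (dat i) e k * y (dec k)) - h i (dat i) e) = 
        (\<Sum>\<kappa>\<in>Us. coef 1 (curry (($$) A)) (curry (($$) B)) (dec e) \<kappa> * y \<kappa>) - offset (curry (($$) F)) (dec e)"
      if e: "e < N" for e y
    proof -
      define Ai where "Ai i = padded lA ms rs i (block lA ms rs i A)" for i
      define Bi where "Bi i = padded lB ps qs i (block lB ps qs i B)" for i
      define Fi where "Fi i = padded lF ms qs i (block lF ms qs i F)" for i
      have sums: "a < m \<Longrightarrow> b < r \<Longrightarrow> (\<Sum>i<n. Ai i a b) = A $$ (a, b)"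
        "a' < p \<Longrightarrow> b' < q \<Longrightarrow> (\<Sum>i<n. Bi i a' b') = B $$ (a', b')"
        "a < m \<Longrightarrow> b' < q \<Longrightarrow> (\<Sum>i<n. Fi i a b') = F $$ (a, b')" for a b a' b'
        unfolding Ai_def Bi_def Fi_def using A B F assms(5-8) by (auto intro!: sum_padded_block)
      have "(\<Sum>i<n. (\<Sum>k<N. H i (dat i) e k * y (dec k)) - h i (dat i) e) =
          (\<Sum>i<n. (\<Sum>\<kappa>\<in>Us. coef (1 / real n) (Ai i) (Bi i) (dec e) \<kappa> * y \<kappa>) - offset (Fi i) (dec e))"
        unfolding sum.reindex_bij_betw[OF dec, symmetric]
        by (simp add: H_def h_def dat_def known_data_def Ai_def Bi_def Fi_def)
      also have "\<dots> = (\<Sum>\<kappa>\<in>Us. (\<Sum>i<n. coef (1 / real n) (Ai i) (Bi i) (dec e) \<kappa>) * y \<kappa>)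
          - (\<Sum>i<n. offset (Fi i) (dec e))"
        unfolding sum_subtractf sum_distrib_right by (subst sum.swap) simp
      also have "(\<Sum>i<n. offset (Fi i) (dec e)) = offset (curry (($$) F)) (dec e)"
        unfolding sum_offset using dec_Us[OF e] by (auto simp: Us_def unknowns_def sums)
      also have "(\<Sum>\<kappa>\<in>Us. (\<Sum>i<n. coef (1 / real n) (Ai i) (Bi i) (dec e) \<kappa>) * y \<kappa>) =
          (\<Sum>\<kappa>\<in>Us. coef 1 (curry (($$) A)) (curry (($$) B)) (dec e) \<kappa> * y \<kappa>)"
      proof (intro sum.cong refl arg_cong2[of _ _ _ _ "(*)"])
        fix \<kappa> assume "\<kappa> \<in> Us"
        then show "(\<Sum>i<n. coef (1 / real n) (Ai i) (Bi i) (dec e) \<kappa>) =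
            coef 1 (curry (($$) A)) (curry (($$) B)) (dec e) \<kappa>"
          unfolding sum_coef using dec_Us[OF e] n by (auto simp: Us_def unknowns_def sums)
      qed
      finally show ?thesis .
    qed
    have T: "T i (dat i) e k = (if N \<le> e \<and> k < N then H i (dat i) (e - N) k else 0)"
      and c: "c i (dat i) e = (if N \<le> e then h i (dat i) (e - N) else 0)" for i e k
      by (simp_all add: T_def c_def)
    have consistent: "\<exists>w. \<forall>j\<in>net.I. lin net.I net.K w j = net.rhs j"
    proof -
      obtain y where "solves_split A B F m r p q y" using split_solvable by blast
      then have "(\<Sum>i<n. (\<Sum>k<N. H i (dat i) e k * y (dec k)) - h i (dat i) e) = 0" if "e < N" for e
        using dec_Us[OF that] unfolding split[OF that] by (simp add: solves_split_def Us_def)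
      then show ?thesis
        by (rule net.stacked_consistent[OF refl T c])
    qed
    have V: "network_states n (part_carrier (estimated_part lA lB lF) r p rs ps) (\<lambda>_. 2 * (2 * N)) = net.V"
      unfolding net.V_def by (simp add: part_carrier_eq[abs_def] rd_def cd_def pt_def)
    have P: "obeys_rules n G W (known_data lA lB lF ms rs ps qs A B F) (agent_rule n (2 * N) rd cd pos T c) = net.P"
      unfolding dat_def[symmetric] net.P_def ..
    have limit: "\<exists>X. least_squares_solution A B F X \<and>
        (\<forall>i<n. converges_exponentially (\<lambda>t. fst (s t i)) (part_of pt rs ps i X))"
      if s: "trajectory n net.V net.P S s" for S s
    proof -
      obtain l where l: "\<forall>j\<in>net.I. lin net.I net.K l j = net.rhs j"
        and conv: "\<And>i. i < n \<Longrightarrow>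
          converges_exponentially (\<lambda>t. fst (s t i)) (mat (rd i) (cd i) (\<lambda>ab. l (i, pos i ab)))"
        using net.trajectory_converges[OF consistent s] by blast
      \<comment> \<open>Agent 0 exists as \<open>n > 0\<close>; by consensus its copy represents
        everyone's.\<close>
      define y where "y \<kappa> = l (0, enc \<kappa>)" for \<kappa>
      have ly: "l (i, k) = y (dec k)" if "i < n" "k < N" for i k
        using net.stacked_solution(1)[OF refl T c l that(1) n that(2)] that(2) by (simp add: y_def enc_dec)
      have "solves_split A B F m r p q y"
        unfolding solves_split_def
      proof
        fix \<epsilon> assume "\<epsilon> \<in> unknowns m r p q"
        then have \<epsilon>: "enc \<epsilon> < N" "dec (enc \<epsilon>) = \<epsilon>" using enc_lt dec_enc by (auto simp: Us_def)
        have "(\<Sum>i<n. (\<Sum>k<N. H i (dat i) (enc \<epsilon>) k * y (dec k)) - h i (dat i) (enc \<epsilon>)) = 0"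
          using net.stacked_solution(2)[OF refl T c l \<epsilon>(1)] by (simp add: ly)
        then show "(\<Sum>\<kappa>\<in>unknowns m r p q. coef 1 (curry (($$) A)) (curry (($$) B)) \<epsilon> \<kappa> * y \<kappa>) =
            offset (curry (($$) F)) \<epsilon>"
          unfolding split[OF \<epsilon>(1)] \<epsilon>(2) Us_def by simp
      qed
      note ls = split_least_squares[OF A B F this]
      define X where "X = mat r p (\<lambda>(a, b). y (VX a b))"
      have "part_of pt rs ps i X = mat (rd i) (cd i) (\<lambda>ab. l (i, pos i ab))" if i: "i < n" for i
      proof -
        have "X $$ part_index pt rs ps i (a, b) = l (i, pos i (a, b))" if "a < rd i" "b < cd i" for a b
          using index[OF i that] enc_lt[OF VX_Us[OF index[OF i that]]] dec_enc[OF VX_Us[OF index[OF i that]]]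
          by (auto simp: pos_def ly[OF i] X_def)
        moreover have "X \<in> carrier_mat r p" by (simp add: X_def)
        ultimately show ?thesis
          by (auto simp: part_of_eq rd_def cd_def)
      qed
      then show ?thesis
        using ls conv by (intro exI[of _ X]) (simp add: X_def)
    qed
    show "let V = network_states n (part_carrier (estimated_part lA lB lF) r p rs ps) (\<lambda>_. 2 * (2 * N));
           P = obeys_rules n G W (known_data lA lB lF ms rs ps qs A B F) (agent_rule n (2 * N) rd cd pos T c)
       in lipschitz_ode n V P \<and>
          (\<forall>S\<^sub>0\<in>V.
             (\<exists>s. trajectory n V P S\<^sub>0 s) \<and>
             (\<forall>s. trajectory n V P S\<^sub>0 s \<longrightarrow>
                (\<exists>X. least_squares_solution A B F X \<and>
                   (\<forall>i<n. converges_exponentially (\<lambda>t. fst (s t i))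
                              (part_of (estimated_part lA lB lF) rs ps i X)))))"
      unfolding Let_def V P
      using net.lipschitz net.trajectory_exists limit unfolding pt_def by blast
  qed
qed

end
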